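(* Let $p\ge 1$, let $m_1\ge1$ and $m_2,\ldots,m_p\ge0$ be integers, let $\mathbf k=(k_1,\ldots,k_r)$ be a non-empty index of positive integers, and let $x\in(0,1)$. Then $$\begin{aligned}\sum_{n=1}^\infty \frac{\zeta_{n-1}(k_2,\ldots,k_r)\,\zeta_n^\star(\mathbf m_p^\vee;x)}{n^{k_1+1}} &=(-1)^p\sum_{\mathbf k',\,j\ge0}c_{\mathbf k}(\mathbf k';j)\sum_{\substack{j_0+\cdots+j_p=j\\ j_0,\ldots,j_p\ge0}}\frac{(-1)^{j_0}}{j_0!}\Bigl\{\prod_{l=1}^p\binom{m_l+j_l}{j_l}\Bigr\}\log^{j_0}(1-x)\\ &\qquad\qquad\times\mathrm{Li}_{m_p+j_p+1,\,m_{p-1}+j_{p-1}+1,\,\ldots,\,m_1+j_1+1,\,\mathbf k'}(1-x)\\ &\quad+\sum_{j=1}^p(-1)^{p-j}\,\zeta\bigl(\mathbf k\circledast(1,\mathbf m_j^\vee)^\star\bigr)\,\mathrm{Li}_{m_p+1,\,m_{p-1}+1,\,\ldots,\,m_{j+1}+1}(1-x),\end{aligned}$$ where the outer sum in the first term runs over indices $\mathbf k'$ (possibly empty) and integers $j\ge 0$ with $|\mathbf k'|+j\le|\mathbf k|$, and for $j=p$ in the last sum the polylogarithm has empty index and equals $1$.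
   Context: An index is a finite sequence of positive integers; $|\mathbf k|$ is the sum of its entries. $\mathrm{Li}_{k_1,\ldots,k_r}(x)=\sum_{n_1>\cdots>n_r\ge1}x^{n_1}/(n_1^{k_1}\cdots n_r^{k_r})$, $\mathrm{Li}_\emptyset=1$. $\zeta_n(k_1,\ldots,k_r)=\sum_{n\ge n_1>\cdots>n_r\ge1}\prod n_j^{-k_j}$, $\zeta^\star_n(k_1,\ldots,k_r)=\sum_{n\ge n_1\ge\cdots\ge n_r\ge1}\prod n_j^{-k_j}$, both equal to $1$ for the empty index. Parametric version: $\zeta_n^\star(m_1,\ldots,m_p;x)=\sum_{n\ge n_1\ge\cdots\ge n_p\ge1}x^{n_p}/(n_1^{m_1}\cdots n_p^{m_p})$. Given $m_1,\ldots,m_p$, put $\mathbf m_j=(m_1,m_2+1,\ldots,m_j+1)$, $\mathbf m_1=(m_1)$. The Hoffman dual of an index $\mathbf a=(a_1,\ldots,a_q)$ is the index $\mathbf a^\vee=(a'_1,\ldots,a'_{q'})$ with the same weight $|\mathbf a|$ such that $\{1,\ldots,|\mathbf a|-1\}$ is the disjoint union of $\{a_1,a_1+a_2,\ldots,a_1+\cdots+a_{q-1}\}$ and $\{a'_1,a'_1+a'_2,\ldots,a'_1+\cdots+a'_{q'-1}\}$. Kaneko–Yamamoto multiple zeta value: for indices $\mathbf k=(k_1,\ldots,k_r)$, $\mathbf l=(l_1,\ldots,l_s)$, $\zeta(\mathbf k\circledast\mathbf l^\star)=\sum_{n\ge1}\zeta_{n-1}(k_2,\ldots,k_r)\zeta_n^\star(l_2,\ldots,l_s)/n^{k_1+l_1}$;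 thus $\zeta(\mathbf k\circledast(1,\mathbf m_j^\vee)^\star)=\sum_{n\ge1}\zeta_{n-1}(k_2,\ldots,k_r)\zeta_n^\star(\mathbf m_j^\vee)/n^{k_1+1}$. The coefficients $c_{\mathbf k}(\mathbf k';j)$ are those in the known theorem of Kaneko and Tsumura: for every index $\mathbf k$, $$\mathrm{Li}_{\mathbf k}(1-y)=\sum_{\mathbf k',\,j\ge0}c_{\mathbf k}(\mathbf k';j)\,\mathrm{Li}_{\{1\}_j}(1-y)\,\mathrm{Li}_{\mathbf k'}(y)\qquad(0<y<1),$$ the sum running over (possibly empty) indices $\mathbf k'$ and $j\ge0$ with $|\mathbf k'|+j\le|\mathbf k|$, where $c_{\mathbf k}(\mathbf k';j)$ is a $\mathbb Q$-linear combination of multiple zeta values of weight $|\mathbf k|-|\mathbf k'|-j$ (the constant $1$ being regarded as a multiple zeta value of weight $0$). Here $\{1\}_j$ is $1$ repeated $j$ times. *)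

theory Defs
  imports "HOL-Analysis.Analysis"
begin

definition is_index :: "nat list \<Rightarrow> bool" where
  "is_index k \<longleftrightarrow> 0 \<notin> set k"

text \<open>The common denominator \<open>n\<^sub>1^k\<^sub>1 \<cdots> n\<^sub>r^k\<^sub>r\<close>; lists are numbered from 0.\<close>

definition index_power :: "nat list \<Rightarrow> nat list \<Rightarrow> real" where
  "index_power ns k = (\<Prod>i<length k. real (ns ! i) ^ (k ! i))"

definition decreasing_tuples :: "nat \<Rightarrow> nat list set" where
  "decreasing_tuples r = {ns. length ns = r \<and> sorted_wrt (>) ns \<and> 0 \<notin> set ns}"

text \<open>All terms below are nonnegative for the arguments in question
  (\<open>0 < x < 1\<close>), so unordered summation agrees with any order of summation.\<close>

definition Li :: "nat list \<Rightarrow> real \<Rightarrow> real" where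
  "Li k x = (if k = [] then 1
     else (\<Sum>\<^sub>\<infinity>ns\<in>decreasing_tuples (length k). x ^ hd ns / index_power ns k))"

definition mzv :: "nat list \<Rightarrow> real" where
  "mzv k = (\<Sum>\<^sub>\<infinity>ns\<in>decreasing_tuples (length k). 1 / index_power ns k)"

text \<open>Indices whose multiple zeta value converges.  The empty index is included; its value
  is \<open>mzv [] = 1\<close>, of weight 0.\<close>

definition admissible :: "nat list \<Rightarrow> bool" where
  "admissible k \<longleftrightarrow> is_index k \<and> (k \<noteq> [] \<longrightarrow> hd k \<ge> 2)"

text \<open>The rational linear combinations of multiple zeta values of weight \<open>w\<close>.\<close>

definition mzv_space :: "nat \<Rightarrow> real set" where
  "mzv_space w = module.span (\<lambda>(q::rat) (v::real). of_rat q * v)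
     (mzv ` {k. admissible k \<and> sum_list k = w})"

definition mhs :: "nat \<Rightarrow> nat list \<Rightarrow> real" where
  "mhs n k = (\<Sum>ns | length ns = length k \<and> set ns \<subseteq> {1..n} \<and> sorted_wrt (>) ns.
     1 / index_power ns k)"

definition weakly_decreasing_tuples :: "nat \<Rightarrow> nat \<Rightarrow> nat list set" where
  "weakly_decreasing_tuples n r = {ns. length ns = r \<and> set ns \<subseteq> {1..n} \<and> sorted_wrt (\<ge>) ns}"

definition mhs_star :: "nat \<Rightarrow> nat list \<Rightarrow> real" where
  "mhs_star n k = (\<Sum>ns\<in>weakly_decreasing_tuples n (length k). 1 / index_power ns k)"

text \<open>The parametric version, meant for nonempty indices only; the parameter is raised to the
  smallest summation variable.\<close>

definition mhs_star_param :: "nat \<Rightarrow> nat list \<Rightarrow> real \<Rightarrow> real" where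
  "mhs_star_param n k x =
     (\<Sum>ns\<in>weakly_decreasing_tuples n (length k). x ^ last ns / index_power ns k)"

definition proper_partial_sums :: "nat list \<Rightarrow> nat set" where
  "proper_partial_sums a = {sum_list (take i a) | i. 1 \<le> i \<and> i < length a}"

definition hoffman_dual :: "nat list \<Rightarrow> nat list" where
  "hoffman_dual a = (THE b. is_index b \<and> sum_list b = sum_list a \<and>
     proper_partial_sums a \<union> proper_partial_sums b = {1..<sum_list a} \<and>
     proper_partial_sums a \<inter> proper_partial_sums b = {})"

text \<open>The index \<open>(m\<^sub>1, m\<^sub>2 + 1, \<dots>, m\<^sub>j + 1)\<close>.\<close>

definition m_index :: "(nat \<Rightarrow> nat) \<Rightarrow> nat \<Rightarrow> nat list" where
  "m_index m j = m 1 # map (\<lambda>i. m i + 1) [2..<Suc j]"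

text \<open>\<open>\<zeta>(k \<circledast> l\<^sup>\<star>)\<close> for nonempty indices; the series converges when \<open>hd k + hd l \<ge> 2\<close>.\<close>

definition kaneko_yamamoto :: "nat list \<Rightarrow> nat list \<Rightarrow> real" where
  "kaneko_yamamoto k l =
     (\<Sum>\<^sub>\<infinity>n\<in>{1..}. mhs (n - 1) (tl k) * mhs_star n (tl l) / real n ^ (hd k + hd l))"

definition kt_range :: "nat list \<Rightarrow> (nat list \<times> nat) set" where
  "kt_range k = {(k', j). is_index k' \<and> sum_list k' + j \<le> sum_list k}"

text \<open>\<open>c\<close> is a system of coefficients as in the Kaneko--Tsumura theorem for the index \<open>k\<close>.
  The theorem asserts that such a \<open>c\<close> exists, but does not single one out.\<close>

definition kt_coefficients :: "nat list \<Rightarrow> (nat list \<Rightarrow> nat \<Rightarrow> real) \<Rightarrow> bool" where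
  "kt_coefficients k c \<longleftrightarrow>
     (\<forall>(k', j)\<in>kt_range k. c k' j \<in> mzv_space (sum_list k - sum_list k' - j)) \<and>
     (\<forall>y. 0 < y \<and> y < 1 \<longrightarrow>
        Li k (1 - y) = (\<Sum>(k', j)\<in>kt_range k. c k' j * Li (replicate j 1) (1 - y) * Li k' y))"

end

theory Submission
  imports Defs "HOL-Real_Asymp.Real_Asymp"
begin

text \<open>Both sides, as functions of \<open>x\<close>, satisfy the same differential equations.  The derivative
  of the parametric series is \<open>(H(1) - H(x)) / (1 - x)\<close> if its index ends in 1, with \<open>H\<close> the series for
  the index without that entry, and \<open>H(x) / x\<close> otherwise, with \<open>H\<close> for the last entry lowered by 1; on the dual
  side these two operations are exactly \<open>m\<^sub>p + 1 \<mapsto> m\<^sub>p\<close> and the removal of \<open>m\<^sub>p = 0\<close>.  On the right,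
  differentiating a polylogarithm at \<open>1 - x\<close> has the same effect, the derivatives of the powers
  of \<open>log (1 - x)\<close> being absorbed by Pascal's rule for the binomial coefficients.  The recursion ends at the
  Kaneko--Tsumura expansion of \<open>Li k x\<close>, where \<open>Li\<close> of \<open>j\<close> ones at \<open>1 - y\<close> is
  \<open>(- log y)\<^sup>j / j!\<close>.  The constants of integration agree because both sides tend to the
  Kaneko--Yamamoto value as \<open>x\<close> tends to 1.\<close>

section \<open>Power series and recursions for the nested sums\<close>

text \<open>The coefficient of \<open>x ^ n\<close> in the power series of \<open>Li k x\<close>.
  The inner sum starts at \<open>i = 0\<close> so that the constant term 1 of the empty index is
  counted; for nonempty indices the coefficient at 0 vanishes.\<close>

primrec Li_coeff :: "nat list \<Rightarrow> nat \<Rightarrow> real" where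
  "Li_coeff [] n = (if n = 0 then 1 else 0)"
| "Li_coeff (a # k) n = (if n = 0 then 0 else (\<Sum>i<n. Li_coeff k i) / real n ^ a)"

text \<open>The value \<open>x ^ n\<close> at the empty index (instead of 1) puts the parameter on the smallest
  summation variable and starts the recursion for the derivatives.\<close>

primrec star_poly :: "nat list \<Rightarrow> nat \<Rightarrow> real \<Rightarrow> real" where
  "star_poly [] n x = x ^ n"
| "star_poly (a # k) n x = (\<Sum>i=1..n. star_poly k i x / real i ^ a)"

lemma index_power_Nil [simp]: "index_power ns [] = 1"
  by (simp add: index_power_def)

lemma index_power_Cons [simp]:
  "index_power (i # ns) (a # k) = real i ^ a * index_power ns k"
  unfolding index_power_def
  by (simp add: prod.lessThan_Suc_shift del: prod.lessThan_Suc)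

definition strict_tuples :: "nat \<Rightarrow> nat \<Rightarrow> nat list set" where
  "strict_tuples n r = {ns. length ns = r \<and> set ns \<subseteq> {1..n} \<and> sorted_wrt (>) ns}"

lemma finite_strict_tuples [simp]: "finite (strict_tuples n r)"
  unfolding strict_tuples_def
  by (rule finite_subset[OF _ finite_lists_length_eq[of "{1..n}" r]]) auto

lemma finite_weakly_decreasing_tuples [simp]: "finite (weakly_decreasing_tuples n r)"
  unfolding weakly_decreasing_tuples_def
  by (rule finite_subset[OF _ finite_lists_length_eq[of "{1..n}" r]]) auto

lemma strict_tuples_0 [simp]: "strict_tuples n 0 = {[]}"
  by (auto simp: strict_tuples_def)

lemma weakly_decreasing_tuples_0 [simp]: "weakly_decreasing_tuples n 0 = {[]}"
  by (auto simp: weakly_decreasing_tuples_def)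

lemma strict_tuples_Suc:
  "strict_tuples n (Suc r) = (\<lambda>(i, t). i # t) ` (SIGMA i:{1..n}. strict_tuples (i - 1) r)"
proof -
  have "ns \<in> (\<lambda>(i, t). i # t) ` (SIGMA i:{1..n}. strict_tuples (i - 1) r)"
    if "ns \<in> strict_tuples n (Suc r)" for ns
  proof -
    obtain i t where ns: "ns = i # t"
      using \<open>ns \<in> strict_tuples n (Suc r)\<close> by (cases ns) (auto simp: strict_tuples_def)
    have "i \<in> {1..n}" "t \<in> strict_tuples (i - 1) r"
      using that by (fastforce simp: ns strict_tuples_def)+
    then show ?thesis using ns by force
  qed
  moreover have "ns \<in> strict_tuples n (Suc r)"
    if "ns \<in> (\<lambda>(i, t). i # t) ` (SIGMA i:{1..n}. strict_tuples (i - 1) r)" for ns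
    using that by (fastforce simp: strict_tuples_def)
  ultimately show ?thesis by blast
qed

lemma weakly_decreasing_tuples_Suc:
  "weakly_decreasing_tuples n (Suc r) =
     (\<lambda>(i, t). i # t) ` (SIGMA i:{1..n}. weakly_decreasing_tuples i r)"
proof -
  have "ns \<in> (\<lambda>(i, t). i # t) ` (SIGMA i:{1..n}. weakly_decreasing_tuples i r)"
    if "ns \<in> weakly_decreasing_tuples n (Suc r)" for ns
  proof -
    obtain i t where ns: "ns = i # t"
      using \<open>ns \<in> weakly_decreasing_tuples n (Suc r)\<close> by (cases ns) (auto simp: weakly_decreasing_tuples_def)
    have "i \<in> {1..n}" "t \<in> weakly_decreasing_tuples i r"
      using that by (fastforce simp: ns weakly_decreasing_tuples_def)+
    then show ?thesis using ns by force
  qed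
  moreover have "ns \<in> weakly_decreasing_tuples n (Suc r)"
    if "ns \<in> (\<lambda>(i, t). i # t) ` (SIGMA i:{1..n}. weakly_decreasing_tuples i r)" for ns
    using that by (fastforce simp: weakly_decreasing_tuples_def)
  ultimately show ?thesis by blast
qed

text \<open>Once the largest variable is fixed, only finitely many tails remain, so an unordered sum
  over tuples becomes a series with finite inner sums.\<close>

lemma decreasing_tuples_Suc:
  "decreasing_tuples (Suc r) = (\<lambda>(i, t). i # t) ` (SIGMA i:{1..}. strict_tuples (i - 1) r)"
proof -
  have "ns \<in> (\<lambda>(i, t). i # t) ` (SIGMA i:{1..}. strict_tuples (i - 1) r)"
    if "ns \<in> decreasing_tuples (Suc r)" for ns
  proof -
    obtain i t where ns: "ns = i # t"
      using \<open>ns \<in> decreasing_tuples (Suc r)\<close> by (cases ns) (auto simp: decreasing_tuples_def)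
    have "i \<in> {1..}" using that by (auto simp: ns decreasing_tuples_def)
    moreover have "t \<in> strict_tuples (i - 1) r"
      using that by (fastforce simp: ns decreasing_tuples_def strict_tuples_def Suc_le_eq
         intro!: gr0I)
    ultimately show ?thesis using ns by force
  qed
  moreover have "ns \<in> decreasing_tuples (Suc r)"
    if "ns \<in> (\<lambda>(i, t). i # t) ` (SIGMA i:{1..}. strict_tuples (i - 1) r)" for ns
    using that by (fastforce simp: decreasing_tuples_def strict_tuples_def)
  ultimately show ?thesis by blast
qed

lemma inj_on_Cons_pair: "inj_on (\<lambda>(i, t). i # t) A"
  by (auto simp: inj_on_def)

lemma sum_Cons_Sigma:
  assumes "finite A" "\<And>i. i \<in> A \<Longrightarrow> finite (B i)"
  shows "(\<Sum>ns\<in>(\<lambda>(i, t). i # t) ` Sigma A B. f ns) = (\<Sum>i\<in>A. \<Sum>t\<in>B i. f (i # t))"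
proof -
  have "(\<Sum>i\<in>A. \<Sum>t\<in>B i. f (i # t)) = (\<Sum>(i, t)\<in>Sigma A B. f (i # t))"
    using assms by (intro sum.Sigma) auto
  also have "\<dots> = (\<Sum>ns\<in>(\<lambda>(i, t). i # t) ` Sigma A B. f ns)"
    unfolding sum.reindex[OF inj_on_Cons_pair] by (intro sum.cong) auto
  finally show ?thesis by simp
qed

lemma mhs_Nil [simp]: "mhs n [] = 1"
  by (simp add: mhs_def strict_tuples_def[symmetric] cong: conj_cong)

lemma mhs_strict_tuples: "mhs n k = (\<Sum>ns\<in>strict_tuples n (length k). 1 / index_power ns k)"
  by (simp add: mhs_def strict_tuples_def)

lemma mhs_Cons: "mhs n (a # k) = (\<Sum>i=1..n. mhs (i - 1) k / real i ^ a)"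
  by (simp add: mhs_strict_tuples strict_tuples_Suc sum_Cons_Sigma
       sum_divide_distrib mult.commute)

text \<open>This links the finite sums in the theorem to power series: via
  \<open>Li_coeff_Cons\<close> the weights of the Kaneko--Yamamoto series become coefficients of a
  polylogarithm.\<close>

lemma mhs_eq_sum_Li_coeff: "mhs n k = (\<Sum>i\<le>n. Li_coeff k i)"
proof (induction k arbitrary: n)
  case (Cons a k)
  have "(\<Sum>i\<le>n. Li_coeff (a # k) i) = (\<Sum>i=1..n. Li_coeff (a # k) i)"
    by (rule sum.mono_neutral_right) (auto simp: not_le)
  also have "\<dots> = (\<Sum>i=1..n. mhs (i - 1) k / real i ^ a)"
  proof (rule sum.cong)
    fix i assume "i \<in> {1..n}"
    then have "{..<i} = {..i - 1}" by auto
    then show "Li_coeff (a # k) i = mhs (i - 1) k / real i ^ a"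
      using \<open>i \<in> {1..n}\<close> by (simp add: Cons.IH)
  qed simp
  finally show ?case by (simp add: mhs_Cons)
qed simp

lemma Li_coeff_Cons: "n > 0 \<Longrightarrow> Li_coeff (a # k) n = mhs (n - 1) k / real n ^ a"
proof -
  assume "n > 0"
  then have "{..<n} = {..n - 1}" by auto
  then show ?thesis using \<open>n > 0\<close> by (simp add: mhs_eq_sum_Li_coeff)
qed

lemma mhs_star_param_eq:
  "k \<noteq> [] \<Longrightarrow> mhs_star_param n k x = star_poly k n x"
proof (induction k arbitrary: n)
  case (Cons a k)
  have *: "mhs_star_param n (a # k) x =
      (\<Sum>i=1..n. (\<Sum>t\<in>weakly_decreasing_tuples i (length k).
         x ^ last (i # t) / index_power t k) / real i ^ a)"
    by (simp add: mhs_star_param_def weakly_decreasing_tuples_Suc sum_Cons_Sigma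
        sum_divide_distrib mult.commute)
  show ?case
  proof (cases "k = []")
    case False
    have "(\<Sum>t\<in>weakly_decreasing_tuples i (length k). x ^ last (i # t) / index_power t k) =
          mhs_star_param i k x" for i
      unfolding mhs_star_param_def
      by (rule sum.cong) (use False in \<open>auto simp: weakly_decreasing_tuples_def\<close>)
    then show ?thesis using False Cons.IH by (simp add: *)
  next
    \<comment> \<open>The tail is empty, so the smallest variable is \<open>i\<close> itself; this
      is what the value \<open>x ^ n\<close> of \<open>star_poly\<close> at the empty index
      provides.\<close>
    case True
    show ?thesis unfolding * by (simp add: True)
  qed
qed simp

lemma mhs_star_eq: "mhs_star n k = star_poly k n 1"
proof (cases "k = []")
  case False
  then have "mhs_star n k = mhs_star_param n k 1"
    by (simp add: mhs_star_def mhs_star_param_def)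
  then show ?thesis using False by (simp add: mhs_star_param_eq)
qed (simp add: mhs_star_def)

section \<open>Growth of the coefficients and the power series of polylogarithms\<close>

lemma Li_coeff_nonneg [simp]: "Li_coeff k n \<ge> 0"
  by (induction k arbitrary: n) (auto intro!: sum_nonneg divide_nonneg_nonneg)

lemma Li_coeff_le: "Li_coeff k n \<le> real n ^ length k"
proof (induction k arbitrary: n)
  case (Cons a k)
  show ?case
  proof (cases "n = 0")
    case False
    have "(\<Sum>i<n. Li_coeff k i) \<le> (\<Sum>i<n. real n ^ length k)"
      by (rule sum_mono, rule order.trans[OF Cons.IH]) (auto intro: power_mono)
    also have "\<dots> = real n ^ length (a # k)" by simp
    finally have "(\<Sum>i<n. Li_coeff k i) / real n ^ a \<le> real n ^ length (a # k) / 1"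
      using False by (intro frac_le) auto
    then show ?thesis using False by simp
  qed auto
qed auto

lemma summable_Li_coeff:
  fixes x :: real
  assumes "\<bar>x\<bar> < 1"
  shows "summable (\<lambda>n. Li_coeff k n * x ^ n)"
proof -
  \<comment> \<open>Replacing \<open>x\<close> by a larger \<open>y\<close> gives a positive base,
    also for \<open>x = 0\<close>, and its geometric decay still beats the polynomial bound on the
    coefficients.\<close>
  obtain y where y: "\<bar>x\<bar> < y" "y < 1" using assms dense by blast
  define r where "r = length k"
  have "y > 0" using y by linarith
  have "(\<lambda>n. real n ^ r * y ^ n) \<in> O(\<lambda>n. 1 / real n ^ 2)"
    using \<open>y > 0\<close> \<open>y < 1\<close> by real_asymp
  moreover have "summable (\<lambda>n. norm (1 / real n ^ 2))"
    using inverse_power_summable[of 2, where 'a=real] by (simp add: field_simps)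
  ultimately have "summable (\<lambda>n. real n ^ length k * y ^ n)"
    unfolding r_def by (rule summable_comparison_test_bigo[rotated])
  moreover have "\<exists>N. \<forall>n\<ge>N. norm (Li_coeff k n * x ^ n) \<le> real n ^ length k * y ^ n"
    using y by (auto simp: abs_mult power_abs intro!: exI[of _ 0] mult_mono Li_coeff_le power_mono)
  ultimately show ?thesis by (rule summable_comparison_test[rotated])
qed

text \<open>Tuples are grouped by their largest variable. All terms are nonnegative, so the
  summability of the resulting power series already justifies the rearrangement.\<close>

lemma Li_sums:
  assumes "0 \<le> x" "x < 1"
  shows "(\<lambda>n. Li_coeff k n * x ^ n) sums Li k x"
proof (cases k)
  case Nil
  have "(\<lambda>n. Li_coeff [] n * x ^ n) sums (\<Sum>n\<in>{0}. Li_coeff [] n * x ^ n)"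
    by (rule sums_finite) simp_all
  then show ?thesis by (simp add: Nil Li_def)
next
  case (Cons a l)
  let ?f = "\<lambda>ns. x ^ hd ns / index_power ns k"
  have "(\<lambda>n. Li_coeff k n * x ^ n) summable_on UNIV"
    using summable_Li_coeff[of x k] assms
    by (intro norm_summable_imp_summable_on) (simp add: abs_mult)
  then have sm: "(\<lambda>n. Li_coeff k n * x ^ n) summable_on {1..}"
    using summable_on_subset_banach by blast
  have inner: "((\<lambda>t. ?f (i # t)) has_sum (Li_coeff k i * x ^ i)) (strict_tuples (i - 1) (length l))"
    if "i \<in> {1..}" for i
  proof -
    have "(\<Sum>t\<in>strict_tuples (i - 1) (length l). ?f (i # t)) = Li_coeff k i * x ^ i"
      using that by (simp add: Cons Li_coeff_Cons mhs_strict_tuples sum_distrib_left sum_divide_distrib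
          mult_ac del: Li_coeff.simps)
    then show ?thesis by (metis has_sum_finite finite_strict_tuples)
  qed
  have "((\<lambda>(i, t). ?f (i # t)) has_sum (\<Sum>\<^sub>\<infinity>n\<in>{1..}. Li_coeff k n * x ^ n))
      (SIGMA i:{1..}. strict_tuples (i - 1) (length l))"
  proof (rule has_sum_SigmaI)
    show inner': "((\<lambda>t. case (i, t) of (i, t) \<Rightarrow> ?f (i # t)) has_sum (Li_coeff k i * x ^ i))
        (strict_tuples (i - 1) (length l))" if "i \<in> {1..}" for i
      using inner[OF that] by (simp only: prod.case)
    show "((\<lambda>n. Li_coeff k n * x ^ n) has_sum (\<Sum>\<^sub>\<infinity>n\<in>{1..}. Li_coeff k n * x ^ n)) {1..}"
      using sm by (rule has_sum_infsum)
    show "(\<lambda>(i, t). ?f (i # t)) summable_on (SIGMA i:{1..}. strict_tuples (i - 1) (length l))"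
    proof (rule summable_on_SigmaI[OF inner' sm])
      show "0 \<le> (case (i, t) of (i, t) \<Rightarrow> ?f (i # t))" for i t
        using assms(1) by (auto simp: index_power_def intro!: divide_nonneg_nonneg prod_nonneg)
    qed
  qed
  then have "(?f has_sum (\<Sum>\<^sub>\<infinity>n\<in>{1..}. Li_coeff k n * x ^ n)) (decreasing_tuples (length k))"
    unfolding Cons list.size(4) add_Suc_right add_0_right decreasing_tuples_Suc has_sum_reindex[OF inj_on_Cons_pair]
    by (simp add: o_def case_prod_beta')
  then have "Li k x = (\<Sum>\<^sub>\<infinity>n\<in>{1..}. Li_coeff k n * x ^ n)"
    by (simp add: Li_def Cons infsumI)
  with sm have "((\<lambda>n. Li_coeff k n * x ^ n) has_sum Li k x) {1..}" by simp
  then have "((\<lambda>n. Li_coeff k n * x ^ n) has_sum Li k x) UNIV"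
    by (subst has_sum_cong_neutral[where T = "{1..}"]) (auto simp: Cons not_le)
  then show ?thesis by (rule has_sum_imp_sums)
qed

section \<open>Derivatives of multiple polylogarithms\<close>

lemma Li_has_field_derivative_powser:
  assumes "0 < y" "y < 1"
  shows "(Li k has_field_derivative (\<Sum>n. diffs (Li_coeff k) n * y ^ n)) (at y)"
proof -
  have "((\<lambda>z. \<Sum>n. Li_coeff k n * z ^ n) has_field_derivative (\<Sum>n. diffs (Li_coeff k) n * y ^ n)) (at y)"
    by (rule termdiffs_strong'[where K = 1]) (use assms in \<open>auto intro: summable_Li_coeff\<close>)
  moreover have *: "\<forall>\<^sub>F z in nhds y. Li k z = (\<Sum>n. Li_coeff k n * z ^ n)"
    using eventually_nhds_in_open[of "{0<..<1}" y] assms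
    by (auto elim!: eventually_mono intro!: sums_unique Li_sums)
  ultimately show ?thesis unfolding DERIV_cong_ev[OF refl * refl] by simp
qed

lemma diffs_Li_coeff_sums:
  assumes "0 < y" "y < 1"
  shows "(\<lambda>n. real n * Li_coeff k n * y ^ n) sums (y * (\<Sum>n. diffs (Li_coeff k) n * y ^ n))"
proof -
  have "summable (\<lambda>n. diffs (Li_coeff k) n * y ^ n)"
    by (rule termdiff_converges[where K = 1]) (use assms in \<open>auto intro: summable_Li_coeff\<close>)
  then have "(\<lambda>n. y * (diffs (Li_coeff k) n * y ^ n)) sums (y * (\<Sum>n. diffs (Li_coeff k) n * y ^ n))"
    by (intro sums_mult summable_sums)
  then have "(\<lambda>n. real (Suc n) * Li_coeff k (Suc n) * y ^ Suc n) sums (y * (\<Sum>n. diffs (Li_coeff k) n * y ^ n))"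
    by (simp add: diffs_def mult_ac)
  then show ?thesis by (subst (asm) sums_Suc_iff) simp
qed

text \<open>The operator \<open>y * d/dy\<close> multiplies the n-th coefficient by \<open>n\<close>
  and keeps the exponent, so derivatives can be compared without shifting indices.\<close>

lemma Li_has_field_derivativeI:
  assumes "0 < y" "y < 1" "(\<lambda>n. real n * Li_coeff k n * y ^ n) sums (y * d)"
  shows "(Li k has_field_derivative d) (at y)"
proof -
  have "y * d = y * (\<Sum>n. diffs (Li_coeff k) n * y ^ n)"
    using sums_unique2[OF assms(3) diffs_Li_coeff_sums[OF assms(1,2)]] .
  then show ?thesis using Li_has_field_derivative_powser[OF assms(1,2)] assms(1) by simp
qed

lemma DERIV_Li_Suc:
  assumes "0 < y" "y < 1"
  shows "(Li (Suc e # k) has_field_derivative Li (e # k) y / y) (at y)"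
proof -
  have "real n * Li_coeff (Suc e # k) n = Li_coeff (e # k) n" for n by simp
  then show ?thesis using Li_sums[of y "e # k"] assms
    by (intro Li_has_field_derivativeI) (auto simp del: Li_coeff.simps)
qed

text \<open>Dividing a power series by \<open>1 - y\<close> replaces its coefficients by their
  partial sums, and \<open>n\<close> times the n-th coefficient for \<open>Suc 0 # k\<close> is the
  partial sum up to \<open>n - 1\<close>. The factor \<open>y\<close> accounts for the shift by
  one.\<close>

lemma DERIV_Li_1:
  assumes "0 < y" "y < 1"
  shows "(Li (Suc 0 # k) has_field_derivative Li k y / (1 - y)) (at y)"
proof (rule Li_has_field_derivativeI[OF assms])
  have "(\<lambda>n. Li_coeff k n * y ^ n) sums Li k y" using Li_sums assms by simp
  moreover have "summable (\<lambda>n. norm (Li_coeff k n * y ^ n))"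
    using summable_Li_coeff[of y k] assms by (simp add: abs_mult)
  moreover have "(\<lambda>n. y ^ n) sums (1 / (1 - y))" "summable (\<lambda>n. norm (y ^ n))"
    using assms geometric_sums[of y] summable_geometric[of y] by (auto simp: power_abs)
  ultimately have "(\<lambda>n. \<Sum>i\<le>n. Li_coeff k i * y ^ i * y ^ (n - i)) sums (Li k y * (1 / (1 - y)))"
    using Cauchy_product_sums[of "\<lambda>n. Li_coeff k n * y ^ n" "\<lambda>n. y ^ n"] by (simp add: sums_iff)
  moreover have "(\<Sum>i\<le>n. Li_coeff k i * y ^ i * y ^ (n - i)) = (\<Sum>i\<le>n. Li_coeff k i) * y ^ n" for n
    unfolding sum_distrib_right by (intro sum.cong) (auto simp: mult.assoc simp flip: power_add)
  ultimately have "(\<lambda>n. y * ((\<Sum>i\<le>n. Li_coeff k i) * y ^ n)) sums (y * (Li k y / (1 - y)))"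
    by (intro sums_mult) simp
  then have "(\<lambda>n. real (Suc n) * Li_coeff (Suc 0 # k) (Suc n) * y ^ Suc n) sums (y * (Li k y / (1 - y)))"
    by (simp add: mult_ac lessThan_Suc_atMost del: of_nat_Suc)
  then show "(\<lambda>n. real n * Li_coeff (Suc 0 # k) n * y ^ n) sums (y * (Li k y / (1 - y)))"
    by (subst (asm) sums_Suc_iff) simp
qed

lemma Li_Nil [simp]: "Li [] y = 1"
  by (simp add: Li_def)

lemma Li_div_tendsto:
  assumes "k \<noteq> []"
  shows "((\<lambda>y. Li k y / y) \<longlongrightarrow> Li_coeff k 1) (at_right 0)"
proof -
  \<comment> \<open>The two-sided derivative at 0 is taken for the power series, since
    \<open>Li_sums\<close> identifies it with \<open>Li\<close> for nonnegative arguments.\<close>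
  let ?f = "\<lambda>z. \<Sum>n. Li_coeff k n * z ^ n"
  have "(?f has_field_derivative (\<Sum>n. diffs (Li_coeff k) n * 0 ^ n)) (at 0)"
    by (rule termdiffs_strong'[where K = 1]) (simp_all add: summable_Li_coeff)
  moreover have "(\<Sum>n. diffs (Li_coeff k) n * 0 ^ n) = Li_coeff k 1"
    unfolding powser_zero by (simp add: diffs_def del: Li_coeff.simps)
  ultimately have "((\<lambda>y. (?f y - ?f 0) / (y - 0)) \<longlongrightarrow> Li_coeff k 1) (at 0)"
    unfolding has_field_derivative_iff by (simp only:)
  then have "((\<lambda>y. (?f y - ?f 0) / (y - 0)) \<longlongrightarrow> Li_coeff k 1) (at_right 0)"
    by (rule tendsto_within_subset) auto
  moreover have "\<forall>\<^sub>F y in at_right 0. (?f y - ?f 0) / (y - 0) = Li k y / y"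
    using eventually_at_right_real[of 0 1, OF zero_less_one]
  proof eventually_elim
    case (elim y)
    have "?f y = Li k y" using sums_unique[OF Li_sums[of y k]] elim by simp
    moreover have "?f 0 = 0" unfolding powser_zero using assms by (cases k) auto
    ultimately show ?case by simp
  qed
  ultimately show ?thesis by (rule Lim_transform_eventually)
qed

text \<open>A polylogarithm with nonempty index is O(y) at 0, which outweighs every power of the
  logarithm.\<close>

lemma Li_tendsto_0:
  assumes "k \<noteq> []"
  shows "((\<lambda>y. ln y ^ i * Li k y) \<longlongrightarrow> 0) (at_right 0)"
proof -
  have "((\<lambda>y::real. ln y ^ i * y) \<longlongrightarrow> 0) (at_right 0)" by real_asymp
  then have "((\<lambda>y. ln y ^ i * y * (Li k y / y)) \<longlongrightarrow> 0 * Li_coeff k 1) (at_right 0)"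
    by (intro tendsto_mult Li_div_tendsto assms)
  moreover have "\<forall>\<^sub>F y in at_right 0. ln y ^ i * y * (Li k y / y) = ln y ^ i * Li k y"
    using eventually_at_right_less[of 0] by eventually_elim simp
  ultimately show ?thesis unfolding mult_zero_left by (rule Lim_transform_eventually)
qed

text \<open>Fixes the constants of integration: they are always read off at the end point 1, where
  the functions in question have limits.\<close>

lemma zero_if_DERIV_zero:
  fixes D :: "real \<Rightarrow> real"
  assumes D: "\<And>z. 0 < z \<Longrightarrow> z < 1 \<Longrightarrow> (D has_field_derivative 0) (at z)"
    and lim: "(D \<longlongrightarrow> 0) (at_left 1)" and y: "0 < y" "y < 1"
  shows "D y = 0"
proof -
  have C: "D z = D y" if "z \<in> {0<..<1}" for z
    using that y by (intro DERIV_isconst3[of 0 1 z y D] D) auto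
  have "\<forall>\<^sub>F z in at_left 1. D z = D y"
    using eventually_at_left_real[of 0 1, OF zero_less_one]
    by (rule eventually_mono) (rule C)
  then have "(D \<longlongrightarrow> D y) (at_left 1)" by (rule tendsto_eventually)
  then show "D y = 0" using lim tendsto_unique[of "at_left (1::real)"] by simp
qed

lemma DERIV_ln_power_fact:
  fixes z :: real
  assumes "0 < z"
  shows "((\<lambda>y. (- ln y) ^ Suc j / fact (Suc j)) has_field_derivative
        - ((- ln z) ^ j / fact j) / z) (at z)"
proof -
  have *: "((\<lambda>y. - ln y) has_field_derivative - (1 / z)) (at z)"
    using assms by (auto intro!: derivative_eq_intros)
  show ?thesis
    by (rule DERIV_cong[OF DERIV_cdivide[OF DERIV_power_Suc[OF *, of j], of "fact (Suc j)"]])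
       (simp add: fact_Suc)
qed

lemma DERIV_comp_1_minus:
  fixes f :: "real \<Rightarrow> real"
  assumes "(f has_field_derivative d) (at (1 - x))"
  shows "((\<lambda>x. f (1 - x)) has_field_derivative - d) (at x)"
proof -
  have "((\<lambda>x. 1 - x) has_field_derivative - 1) (at x)"
    by (auto intro!: derivative_eq_intros)
  from DERIV_chain2[where f = f and g = "\<lambda>x. 1 - x", OF assms this] show ?thesis by simp
qed

text \<open>Induction on \<open>j\<close>: in \<open>y\<close>, both sides have as derivative the
  negative of the previous case divided by \<open>y\<close>, and both vanish as \<open>y\<close>
  tends to 1.\<close>

lemma Li_ones:
  assumes "0 < y" "y < 1"
  shows "Li (replicate j 1) (1 - y) = (- ln y) ^ j / fact j"
  using assms
proof (induction j arbitrary: y)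
  case (Suc j)
  define D where "D = (\<lambda>y. Li (replicate (Suc j) 1) (1 - y) - (- ln y) ^ Suc j / fact (Suc j))"
  have "D y = 0"
  proof (rule zero_if_DERIV_zero[of D])
    fix z :: real assume z: "0 < z" "z < 1"
    have "((\<lambda>y. Li (Suc 0 # replicate j 1) (1 - y)) has_field_derivative
        - (Li (replicate j 1) (1 - z) / (1 - (1 - z)))) (at z)"
      by (rule DERIV_comp_1_minus[OF DERIV_Li_1]) (use z in auto)
    from DERIV_diff[OF this DERIV_ln_power_fact[OF z(1), of j]]
    have "(D has_field_derivative - (Li (replicate j 1) (1 - z) / (1 - (1 - z)))
          - (- ((- ln z) ^ j / fact j) / z)) (at z)"
      unfolding D_def by (simp only: replicate_Suc One_nat_def)
    then show "(D has_field_derivative 0) (at z)" using Suc.IH[OF z] by simp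
  next
    have "filterlim (\<lambda>y::real. 1 - y) (at_right 0) (at_left 1)" by real_asymp
    from filterlim_compose[OF Li_tendsto_0[of "replicate (Suc j) 1" 0] this]
    have 1: "((\<lambda>y. Li (replicate (Suc j) 1) (1 - y)) \<longlongrightarrow> 0) (at_left 1)" by simp
    have "((\<lambda>y::real. - ln y) \<longlongrightarrow> 0) (at_left 1)" by real_asymp
    from tendsto_divide[OF tendsto_power[OF this, of "Suc j"] tendsto_const[of "fact (Suc j)"]]
    have "((\<lambda>y::real. (- ln y) ^ Suc j / fact (Suc j)) \<longlongrightarrow> 0) (at_left 1)"
      unfolding power_0_Suc div_0 by simp
    from tendsto_diff[OF 1 this] show "(D \<longlongrightarrow> 0) (at_left 1)"
      unfolding D_def by simp
  qed (use Suc.prems in auto)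
  then show ?case by (simp add: D_def)
qed simp

section \<open>Kaneko--Yamamoto series with a parameter\<close>

text \<open>Only the innermost sum involves \<open>x\<close>. Its derivative is a finite geometric
  sum with value \<open>(1 - x ^ n) / (1 - x)\<close>, and the outer sums act linearly on
  it.\<close>

lemma DERIV_star_poly_snoc_1:
  assumes "0 < x" "x < 1"
  shows "(star_poly (a @ [Suc 0]) n has_field_derivative
           (star_poly a n 1 - star_poly a n x) / (1 - x)) (at x)"
proof (induction a arbitrary: n)
  case Nil
  have "((\<lambda>x. \<Sum>i=1..n. x ^ i / real i ^ Suc 0) has_field_derivative (\<Sum>i=1..n. x ^ (i - 1))) (at x)"
  proof (rule DERIV_sum)
    fix i assume "i \<in> {1..n}"
    then obtain j where "i = Suc j" by (cases i) auto
    have "((\<lambda>x. x ^ Suc j / real (Suc j)) has_field_derivative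
        (1 + real j) * (1 * x ^ j) / real (Suc j)) (at x)"
      by (rule DERIV_cdivide[OF DERIV_power_Suc[OF DERIV_ident]])
    then show "((\<lambda>x. x ^ i / real i ^ Suc 0) has_field_derivative x ^ (i - 1)) (at x)"
      by (simp add: \<open>i = Suc j\<close>)
  qed
  moreover have "(\<Sum>i=1..n. x ^ (i - 1)) = (1 - x ^ n) / (1 - x)"
  proof -
    have "(\<Sum>i=1..n. x ^ (i - 1)) = (\<Sum>i<n. x ^ i)"
      by (rule sum.reindex_bij_witness[of _ Suc "\<lambda>i. i - 1"]) auto
    also have "\<dots> = (1 - x ^ n) / (1 - x)"
      using assms by (simp add: sum_gp_strict)
    finally show ?thesis .
  qed
  ultimately show ?case by simp
next
  case (Cons b a)
  have "((\<lambda>x. \<Sum>i=1..n. star_poly (a @ [Suc 0]) i x / real i ^ b) has_field_derivative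
      (\<Sum>i=1..n. (star_poly a i 1 - star_poly a i x) / (1 - x) / real i ^ b)) (at x)"
    by (intro DERIV_sum DERIV_cdivide Cons.IH)
  then show ?case
    by (simp add: sum_subtractf diff_divide_distrib sum_divide_distrib mult.commute)
qed

lemma DERIV_star_poly_snoc_Suc:
  assumes "0 < x"
  shows "(star_poly (a @ [Suc b]) n has_field_derivative star_poly (a @ [b]) n x / x) (at x)"
proof (induction a arbitrary: n)
  case Nil
  have "((\<lambda>x. \<Sum>i=1..n. x ^ i / real i ^ Suc b) has_field_derivative
      (\<Sum>i=1..n. x ^ i / real i ^ b / x)) (at x)"
  proof (rule DERIV_sum)
    fix i assume "i \<in> {1..n}"
    then obtain j where j: "i = Suc j" by (cases i) auto
    have "((\<lambda>x. x ^ Suc j / real (Suc j) ^ Suc b) has_field_derivative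
        (1 + real j) * (1 * x ^ j) / real (Suc j) ^ Suc b) (at x)"
      by (rule DERIV_cdivide[OF DERIV_power_Suc[OF DERIV_ident]])
    then show "((\<lambda>x. x ^ i / real i ^ Suc b) has_field_derivative x ^ i / real i ^ b / x) (at x)"
      using assms by (simp add: j)
  qed
  then show ?case by (simp add: sum_divide_distrib)
next
  case (Cons c a)
  have "((\<lambda>x. \<Sum>i=1..n. star_poly (a @ [Suc b]) i x / real i ^ c) has_field_derivative
      (\<Sum>i=1..n. star_poly (a @ [b]) i x / x / real i ^ c)) (at x)"
    by (intro DERIV_sum DERIV_cdivide Cons.IH)
  then show ?case by (simp add: sum_divide_distrib mult.commute)
qed

section \<open>Monotonicity and logarithmic bounds for the nested sums\<close>

lemma star_poly_nonneg: "0 \<le> x \<Longrightarrow> 0 \<le> star_poly a n x"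
  by (induction a arbitrary: n) (auto intro!: sum_nonneg divide_nonneg_nonneg)

lemma star_poly_mono: "0 \<le> x \<Longrightarrow> x \<le> y \<Longrightarrow> star_poly a n x \<le> star_poly a n y"
  by (induction a arbitrary: n) (auto intro!: sum_mono divide_right_mono power_mono)

lemma continuous_on_star_poly: "continuous_on S (star_poly a n)"
proof (induction a arbitrary: n)
  case (Cons b a)
  have "continuous_on S (\<lambda>x. \<Sum>i=1..n. star_poly a i x / real i ^ b)"
    by (intro continuous_on_sum continuous_on_divide Cons.IH continuous_on_const) auto
  then show ?case by simp
qed (auto intro: continuous_intros)

text \<open>The common induction step of the bounds for \<open>star_poly\<close> and
  \<open>mhs\<close>: each entry of an index costs one factor \<open>harm n\<close>.\<close>

lemma sum_inverse_power_le_harm: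
  assumes "a > 0" "\<And>i. i \<in> {1..n} \<Longrightarrow> f i \<le> harm n ^ r"
  shows "(\<Sum>i=1..n. f i / real i ^ a) \<le> harm n ^ Suc r"
proof -
  have "(\<Sum>i=1..n. f i / real i ^ a) \<le> (\<Sum>i=1..n. harm n ^ r * inverse (real i))"
  proof (rule sum_mono)
    fix i assume i: "i \<in> {1..n}"
    have "real i ^ 1 \<le> real i ^ a" using i assms(1) by (intro power_increasing) auto
    then have "f i / real i ^ a \<le> harm n ^ r / real i"
      using assms(2)[OF i] i by (intro frac_le) (auto simp: harm_nonneg)
    then show "f i / real i ^ a \<le> harm n ^ r * inverse (real i)" by (simp add: field_simps)
  qed
  also have "\<dots> = harm n ^ Suc r"
    by (simp add: harm_def sum_distrib_left[symmetric])
  finally show ?thesis .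
qed

lemma star_poly_le_harm: "is_index a \<Longrightarrow> star_poly a n 1 \<le> harm n ^ length a"
proof (induction a arbitrary: n)
  case (Cons b a)
  have "star_poly a i 1 \<le> harm n ^ length a" if "i \<in> {1..n}" for i
  proof -
    have "star_poly a i 1 \<le> harm i ^ length a" using Cons by (auto simp: is_index_def)
    also have "\<dots> \<le> harm n ^ length a" using that by (intro power_mono harm_mono harm_nonneg) auto
    finally show ?thesis .
  qed
  moreover have "b > 0" using Cons.prems by (auto simp: is_index_def)
  ultimately show ?case
    using sum_inverse_power_le_harm[of b n "\<lambda>i. star_poly a i 1" "length a"] by simp
qed simp

lemma mhs_le_harm: "is_index a \<Longrightarrow> mhs n a \<le> harm n ^ length a"
proof (induction a arbitrary: n)
  case (Cons b a)
  have "mhs (i - 1) a \<le> harm n ^ length a" if "i \<in> {1..n}" for i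
  proof -
    have "mhs (i - 1) a \<le> harm (i - 1) ^ length a" using Cons by (auto simp: is_index_def)
    also have "\<dots> \<le> harm n ^ length a" using that by (intro power_mono harm_mono harm_nonneg) auto
    finally show ?thesis .
  qed
  moreover have "b > 0" using Cons.prems by (auto simp: is_index_def)
  ultimately show ?case
    using sum_inverse_power_le_harm[of b n "\<lambda>i. mhs (i - 1) a" "length a"] by (simp add: mhs_Cons)
qed simp

lemma mhs_nonneg: "0 \<le> mhs n k"
  by (simp add: mhs_eq_sum_Li_coeff sum_nonneg)

lemma harm_le_ln: "n > 0 \<Longrightarrow> harm n \<le> 1 + ln (real n)"
  using euler_mascheroni_sequence_decreasing[of 1 n] by (simp add: harm_expand)

text \<open>The extra 1 in the exponent is the leading entry of the starred index
  \<open>(1, m\<^sub>j\<^sup>\<or>)\<close>. For \<open>n > 0\<close> this is the n-th coefficient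
  of the polylogarithm of \<open>k\<close> with its first entry raised by 1.\<close>

definition ky_weight :: "nat list \<Rightarrow> nat \<Rightarrow> real" where
  "ky_weight k n = mhs (n - 1) (tl k) / real n ^ (hd k + 1)"

definition ky_series :: "nat list \<Rightarrow> nat list \<Rightarrow> real \<Rightarrow> real" where
  "ky_series k a x = (\<Sum>n. ky_weight k n * star_poly a n x)"

text \<open>Division by zero gives 0 here, so summing from 0 agrees with summing from 1.\<close>

lemma ky_weight_0 [simp]: "ky_weight k 0 = 0"
  by (simp add: ky_weight_def)

lemma ky_weight_nonneg: "0 \<le> ky_weight k n"
  by (simp add: ky_weight_def mhs_nonneg)

text \<open>Both nested sums are bounded by powers of \<open>1 + ln n\<close>, while the denominator
  is at least \<open>n ^ 2\<close> because the first entry of \<open>k\<close> is positive.\<close>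

lemma ky_summable_1:
  assumes "is_index k" "k \<noteq> []" "is_index a"
  shows "summable (\<lambda>n. ky_weight k n * star_poly a n 1)"
proof -
  define r where "r = length (tl k) + length a"
  \<comment> \<open>Any exponent strictly between -2 and -1 would do: it leaves room for the
    logarithms and is still summable.\<close>
  have "(\<lambda>n. (1 + ln (real n)) ^ r / real n ^ 2) \<in> O(\<lambda>n. real n powr (-3/2))"
    by real_asymp
  moreover have "summable (\<lambda>n. norm (real n powr (-3/2)))"
    by (simp add: summable_real_powr_iff)
  ultimately have sm: "summable (\<lambda>n. (1 + ln (real n)) ^ r / real n ^ 2)"
    by (rule summable_comparison_test_bigo[rotated])
  have "norm (ky_weight k n * star_poly a n 1) \<le> (1 + ln (real n)) ^ r / real n ^ 2" if "n \<ge> 1" for n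
  proof -
    have "hd k \<ge> 1" using assms(1,2) by (cases k) (auto simp: is_index_def)
    then have pw: "real n ^ 2 \<le> real n ^ (hd k + 1)" using that by (intro power_increasing) auto
    have "mhs (n - 1) (tl k) \<le> harm (n - 1) ^ length (tl k)"
      using assms(1,2) by (intro mhs_le_harm) (cases k, auto simp: is_index_def)
    also have "\<dots> \<le> harm n ^ length (tl k)" by (intro power_mono harm_mono harm_nonneg) auto
    finally have "mhs (n - 1) (tl k) * star_poly a n 1 \<le> harm n ^ length (tl k) * harm n ^ length a"
      using star_poly_le_harm[OF assms(3)]
      by (intro mult_mono) (auto simp: star_poly_nonneg harm_nonneg)
    also have "\<dots> \<le> (1 + ln (real n)) ^ r"
      unfolding r_def power_add[symmetric] using that by (intro power_mono harm_le_ln harm_nonneg) auto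
    finally have "mhs (n - 1) (tl k) * star_poly a n 1 / real n ^ (hd k + 1)
        \<le> (1 + ln (real n)) ^ r / real n ^ 2"
      using pw that by (intro frac_le) (auto simp: mhs_nonneg star_poly_nonneg)
    then show ?thesis
      by (simp add: ky_weight_def mhs_nonneg star_poly_nonneg abs_mult del: power_Suc)
  qed
  then show ?thesis by (intro summable_comparison_test[OF _ sm] exI[of _ 1]) blast
qed

context
  fixes k :: "nat list"
  assumes k: "is_index k" "k \<noteq> []"
begin

lemma ky_term_bound:
  assumes "0 \<le> x" "x \<le> 1"
  shows "norm (ky_weight k n * star_poly a n x) \<le> ky_weight k n * star_poly a n 1"
  using assms star_poly_mono[of x 1 a n]
  by (auto simp: abs_mult ky_weight_nonneg star_poly_nonneg intro!: mult_left_mono)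

lemma ky_sums:
  assumes "is_index a" "0 \<le> x" "x \<le> 1"
  shows "(\<lambda>n. ky_weight k n * star_poly a n x) sums ky_series k a x"
  unfolding ky_series_def
  by (rule summable_sums, rule summable_comparison_test[OF _ ky_summable_1[OF k assms(1)]])
     (use ky_term_bound assms in blast)

text \<open>The terms at \<open>x = 1\<close> are a summable majorant on the closed unit interval,
  so the series is continuous up to 1.\<close>

lemma ky_tendsto:
  assumes "is_index a"
  shows "(ky_series k a \<longlongrightarrow> ky_series k a 1) (at_left 1)"
proof -
  have "uniform_limit {0..1} (\<lambda>N x. \<Sum>n<N. ky_weight k n * star_poly a n x)
      (\<lambda>x. \<Sum>n. ky_weight k n * star_poly a n x) sequentially"
    by (rule Weierstrass_m_test[OF _ ky_summable_1[OF k assms]]) (use ky_term_bound in auto)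
  moreover have "\<forall>\<^sub>F N in sequentially. continuous_on {0..1}
      (\<lambda>x. \<Sum>n<N. ky_weight k n * star_poly a n x)"
    by (intro always_eventually allI continuous_on_sum continuous_on_mult continuous_on_const
         continuous_on_star_poly)
  ultimately have "continuous_on {0..1} (ky_series k a)"
    unfolding ky_series_def by (intro uniform_limit_theorem) auto
  then have "(ky_series k a \<longlongrightarrow> ky_series k a 1) (at 1 within {0..1})"
    by (auto simp: continuous_on_def)
  moreover have "at_left 1 = at 1 within {0..1::real}"
    by (simp add: at_within_Icc_at_left)
  ultimately show ?thesis by simp
qed

text \<open>Termwise differentiation. The factor \<open>1 / (x * (1 - x))\<close> is bounded on
  compact subintervals of (0,1), so one bound by values at 1 serves both kinds of last
  entry.\<close>

lemma DERIV_ky_series_dominated: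
  assumes "is_index a" "is_index b" and x: "0 < x" "x < 1"
    and D: "\<And>n x. 0 < x \<Longrightarrow> x < 1 \<Longrightarrow> (star_poly a n has_field_derivative f' n x) (at x)"
    and bd: "\<And>n x. 0 < x \<Longrightarrow> x < 1 \<Longrightarrow> \<bar>f' n x\<bar> \<le> star_poly b n 1 / (x * (1 - x))"
    and sm: "(\<lambda>n. ky_weight k n * f' n x) sums d"
  shows "(ky_series k a has_field_derivative d) (at x)"
proof -
  define u v where "u = x / 2" and "v = (1 + x) / 2"
  have uv: "0 < u" "u < x" "x < v" "v < 1" using x by (auto simp: u_def v_def)
  have *: "norm (ky_weight k n * f' n y) \<le> ky_weight k n * star_poly b n 1 / (u * (1 - v))"
    if "y \<in> {u..v}" for n y
  proof -
    have "\<bar>f' n y\<bar> \<le> star_poly b n 1 / (y * (1 - y))" using that uv by (intro bd) auto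
    also have "\<dots> \<le> star_poly b n 1 / (u * (1 - v))"
      using that uv by (intro divide_left_mono mult_mono mult_pos_pos) (auto simp: star_poly_nonneg)
    finally have "ky_weight k n * \<bar>f' n y\<bar> \<le> ky_weight k n * (star_poly b n 1 / (u * (1 - v)))"
      by (intro mult_left_mono ky_weight_nonneg)
    then show ?thesis by (simp add: abs_mult ky_weight_nonneg)
  qed
  have "((\<lambda>x. \<Sum>n. ky_weight k n * star_poly a n x) has_field_derivative
     (\<Sum>n. ky_weight k n * f' n x)) (at x)"
  proof (rule has_field_derivative_series'(2))
    show "convex {u..v}" by simp
    show "((\<lambda>x. ky_weight k n * star_poly a n x) has_field_derivative ky_weight k n * f' n y)
        (at y within {u..v})" if "y \<in> {u..v}" for n y
      using that uv by (intro DERIV_cmult has_field_derivative_at_within[OF D]) auto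
    show "uniformly_convergent_on {u..v} (\<lambda>N y. \<Sum>n<N. ky_weight k n * f' n y)"
      unfolding uniformly_convergent_on_def
      by (rule exI, rule Weierstrass_m_test[OF * summable_divide[OF ky_summable_1[OF k assms(2)]]])
    show "x \<in> {u..v}" "x \<in> interior {u..v}" using uv by auto
    show "summable (\<lambda>n. ky_weight k n * star_poly a n x)"
      using ky_sums[of a x] assms by (auto simp: sums_iff)
  qed
  then show ?thesis using sm by (simp add: ky_series_def[abs_def] sums_iff)
qed

lemma DERIV_ky_series_snoc_1:
  assumes "is_index a" "0 < x" "x < 1"
  shows "(ky_series k (a @ [Suc 0]) has_field_derivative
           (ky_series k a 1 - ky_series k a x) / (1 - x)) (at x)"
proof (rule DERIV_ky_series_dominated[OF _ assms(1) assms(2,3) DERIV_star_poly_snoc_1])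
  show "is_index (a @ [Suc 0])" using assms by (auto simp: is_index_def)
  fix n and x :: real assume x: "0 < x" "x < 1"
  have "\<bar>(star_poly a n 1 - star_poly a n x) / (1 - x)\<bar> = (star_poly a n 1 - star_poly a n x) / (1 - x)"
    using x star_poly_mono[of x 1 a n] by simp
  also have "\<dots> \<le> star_poly a n 1 / (x * (1 - x))"
    using x by (intro frac_le) (auto simp: star_poly_nonneg)
  finally show "\<bar>(star_poly a n 1 - star_poly a n x) / (1 - x)\<bar> \<le> star_poly a n 1 / (x * (1 - x))" .
next
  have "(\<lambda>n. (ky_weight k n * star_poly a n 1 - ky_weight k n * star_poly a n x) / (1 - x)) sums
     ((ky_series k a 1 - ky_series k a x) / (1 - x))"
    using assms by (intro sums_divide sums_diff ky_sums) auto
  then show "(\<lambda>n. ky_weight k n * ((star_poly a n 1 - star_poly a n x) / (1 - x))) sums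
     ((ky_series k a 1 - ky_series k a x) / (1 - x))"
    by (simp add: right_diff_distrib)
qed

lemma DERIV_ky_series_snoc_Suc:
  assumes "is_index (a @ [b])" "0 < x" "x < 1"
  shows "(ky_series k (a @ [Suc b]) has_field_derivative ky_series k (a @ [b]) x / x) (at x)"
proof (rule DERIV_ky_series_dominated[OF _ assms(1) assms(2,3) DERIV_star_poly_snoc_Suc])
  show "is_index (a @ [Suc b])" using assms by (auto simp: is_index_def)
  fix n and x :: real assume x: "0 < x" "x < 1"
  have "\<bar>star_poly (a @ [b]) n x / x\<bar> = star_poly (a @ [b]) n x / x"
    using x by (simp add: star_poly_nonneg)
  also have "\<dots> \<le> star_poly (a @ [b]) n 1 / (x * (1 - x))"
    using x star_poly_mono[of x 1 "a @ [b]" n] by (intro frac_le) (auto simp: star_poly_nonneg mult_le_cancel_left1)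
  finally show "\<bar>star_poly (a @ [b]) n x / x\<bar> \<le> star_poly (a @ [b]) n 1 / (x * (1 - x))" .
next
  have "(\<lambda>n. ky_weight k n * star_poly (a @ [b]) n x / x) sums (ky_series k (a @ [b]) x / x)"
    using assms by (intro sums_divide ky_sums) auto
  then show "(\<lambda>n. ky_weight k n * (star_poly (a @ [b]) n x / x)) sums (ky_series k (a @ [b]) x / x)"
    by simp
qed

text \<open>With an empty star index the series is the polylogarithm of \<open>k\<close> with its
  first entry raised by 1; differentiation lowers that entry again.\<close>

lemma DERIV_ky_series_Nil:
  assumes "0 < x" "x < 1"
  shows "(ky_series k [] has_field_derivative Li k x / x) (at x)"
proof -
  have *: "ky_series k [] z = Li (Suc (hd k) # tl k) z" if "z \<in> {0<..<1}" for z
  proof -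
    have "ky_weight k n * z ^ n = Li_coeff (Suc (hd k) # tl k) n * z ^ n" for n
      by (cases "n = 0") (simp_all add: ky_weight_def Li_coeff_Cons del: Li_coeff.simps(2) power_Suc, simp)
    then have "(\<lambda>n. ky_weight k n * star_poly [] n z) sums Li (Suc (hd k) # tl k) z"
      using Li_sums[of z "Suc (hd k) # tl k"] that by (simp del: Li_coeff.simps)
    then show ?thesis by (simp add: ky_series_def sums_iff)
  qed
  have "\<forall>\<^sub>F z in nhds x. Li (Suc (hd k) # tl k) z = ky_series k [] z"
    using eventually_nhds_in_open[of "{0<..<1}" x] assms by (auto elim!: eventually_mono simp: *)
  from DERIV_cong_ev[OF refl this refl] DERIV_Li_Suc[OF assms, of "hd k" "tl k"] k(2)
  show ?thesis by simp
qed

end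

section \<open>Logarithmic sums of polylogarithms\<close>

text \<open>For the list \<open>[m\<^sub>p, \<dots>, m\<^sub>1]\<close> this is the sum over
  \<open>j\<^sub>1 + \<dots> + j\<^sub>p = s\<close> of the products of binomial coefficients times
  \<open>f\<close> at the raised entries. It recurses on the first entry, since that is where
  differentiation acts.\<close>

primrec binomial_sum :: "nat list \<Rightarrow> nat \<Rightarrow> (nat list \<Rightarrow> real) \<Rightarrow> real" where
  "binomial_sum [] s f = (if s = 0 then f [] else 0)"
| "binomial_sum (a # ms) s f =
     (\<Sum>b\<le>s. real ((a + b) choose b) * binomial_sum ms (s - b) (\<lambda>v. f ((a + b + 1) # v)))"

lemma binomial_sum_cmult: "binomial_sum ms s (\<lambda>v. c * f v) = c * binomial_sum ms s f"
  by (induction ms arbitrary: s f) (simp_all add: sum_distrib_left mult.left_commute)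

lemma binomial_sum_divide: "binomial_sum ms s (\<lambda>v. f v / c) = binomial_sum ms s f / c"
  using binomial_sum_cmult[of ms s "1 / c" f] by simp

lemma DERIV_binomial_sum:
  assumes "\<And>v. (f v has_field_derivative f' v) (at y)"
  shows "((\<lambda>y. binomial_sum ms s (\<lambda>v. f v y)) has_field_derivative binomial_sum ms s f') (at y)"
  using assms
proof (induction ms arbitrary: s f f')
  case Nil
  then show ?case by simp
next
  case (Cons a ms)
  show ?case unfolding binomial_sum.simps
    by (intro DERIV_sum DERIV_cmult Cons.IH Cons.prems)
qed

lemma binomial_sum_tendsto_0:
  assumes "\<And>v. (f v \<longlongrightarrow> 0) F"
  shows "((\<lambda>y. binomial_sum ms s (\<lambda>v. f v y)) \<longlongrightarrow> 0) F"
  using assms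
proof (induction ms arbitrary: s f)
  case Nil
  then show ?case by (cases "s = 0") simp_all
next
  case (Cons a ms)
  show ?case unfolding binomial_sum.simps
    by (intro tendsto_null_sum tendsto_mult_right_zero Cons.IH Cons.prems)
qed

text \<open>Makes the share \<open>s\<close> of the remaining entries the outer variable, so that
  the power of the logarithm and the first entry can be treated together for fixed
  \<open>s\<close>.\<close>

lemma sum_triangle_swap:
  fixes g :: "nat \<Rightarrow> nat \<Rightarrow> nat \<Rightarrow> real"
  shows "(\<Sum>i\<le>j. \<Sum>b\<le>j - i. g i b (j - i - b)) = (\<Sum>s\<le>j. \<Sum>i\<le>j - s. g i (j - s - i) s)"
  unfolding sum.Sigma[OF finite_atMost ballI[OF finite_atMost]]
  by (rule sum.reindex_bij_witness[of _ "\<lambda>(s, i). (i, j - s - i)" "\<lambda>(i, b). (j - i - b, i)"]) auto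

text \<open>For \<open>0 < y < 1\<close> this is \<open>Li (replicate i 1) (1 - y)\<close>, by
  \<open>Li_ones\<close>.\<close>

abbreviation ln_power :: "nat \<Rightarrow> real \<Rightarrow> real" where
  "ln_power i y \<equiv> (- ln y) ^ i / fact i"

lemma DERIV_ln_power:
  assumes "0 < y"
  shows "(ln_power i has_field_derivative (if i = 0 then 0 else - ln_power (i - 1) y / y)) (at y)"
  using DERIV_ln_power_fact[OF assms, of "i - 1"] by (cases i) auto

text \<open>Differentiating the logarithm in the term \<open>i + 1\<close> produces the i-th power,
  so the result is collected by powers; the top term \<open>n\<close> receives no such
  contribution.\<close>

lemma DERIV_ln_power_sum:
  assumes "0 < y" and h: "\<And>i. i \<le> n \<Longrightarrow> (h i has_field_derivative h' i) (at y)"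
  shows "((\<lambda>y. \<Sum>i\<le>n. ln_power i y * h i y) has_field_derivative
     (\<Sum>i<n. ln_power i y * (h' i - h (Suc i) y / y)) + ln_power n y * h' n) (at y)"
proof -
  let ?d = "\<lambda>i. if i = 0 then 0 else - ln_power (i - 1) y / y"
  have "((\<lambda>y. \<Sum>i\<le>n. ln_power i y * h i y) has_field_derivative
     (\<Sum>i\<le>n. ?d i * h i y + h' i * ln_power i y)) (at y)"
    by (rule DERIV_sum, rule DERIV_mult[OF DERIV_ln_power[OF assms(1)] h]) simp
  moreover have "(\<Sum>i\<le>n. ?d i * h i y) = (\<Sum>i<n. - ln_power i y / y * h (Suc i) y)"
    by (subst sum.atMost_shift) simp
  moreover have "(\<Sum>i\<le>n. h' i * ln_power i y) = (\<Sum>i<n. h' i * ln_power i y) + h' n * ln_power n y"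
    by (simp only: lessThan_Suc_atMost[symmetric] sum.lessThan_Suc)
  ultimately show ?thesis
    by (simp add: sum.distrib sum_subtractf sum_negf algebra_simps)
qed

text \<open>Here \<open>h e\<close> stands for a sum of polylogarithms with first entry
  \<open>e\<close>. At each power of the logarithm two binomial coefficients are subtracted, and
  Pascal's rule leaves the one belonging to \<open>a\<close>.\<close>

lemma DERIV_ln_binomial_sum_Suc:
  assumes "0 < y" and h: "\<And>e. (h (Suc (Suc e)) has_field_derivative h (Suc e) y / y) (at y)"
  shows "((\<lambda>y. \<Sum>i\<le>n. ln_power i y * (real ((Suc a + (n - i)) choose (n - i)) * h (Suc a + (n - i) + 1) y))
     has_field_derivative
     (\<Sum>i\<le>n. ln_power i y * (real ((a + (n - i)) choose (n - i)) * h (a + (n - i) + 1) y)) / y) (at y)"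
proof -
  let ?h' = "\<lambda>i. real ((Suc a + (n - i)) choose (n - i)) * (h (a + (n - i) + 1) y / y)"
  have eq: "?h' i - real ((Suc a + (n - Suc i)) choose (n - Suc i)) * h (Suc a + (n - Suc i) + 1) y / y
     = real ((a + (n - i)) choose (n - i)) * h (a + (n - i) + 1) y / y" if i: "i < n" for i
  proof -
    obtain q where q: "n - i = Suc q" "n - Suc i = q" using i by (metis Suc_diff_Suc)
    have "real ((Suc a + Suc q) choose Suc q) = real ((a + Suc q) choose Suc q) + real ((Suc a + q) choose q)"
      by simp
    then show ?thesis unfolding q
      by (simp add: algebra_simps add_divide_distrib[symmetric] diff_divide_distrib[symmetric] del: binomial_Suc_Suc)
  qed
  have "((\<lambda>y. \<Sum>i\<le>n. ln_power i y * (real ((Suc a + (n - i)) choose (n - i)) * h (Suc a + (n - i) + 1) y))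
     has_field_derivative
     (\<Sum>i<n. ln_power i y * (?h' i - real ((Suc a + (n - Suc i)) choose (n - Suc i)) * h (Suc a + (n - Suc i) + 1) y / y))
      + ln_power n y * ?h' n) (at y)"
    using h by (intro DERIV_ln_power_sum assms(1) DERIV_cmult) simp
  moreover have "(\<Sum>i<n. ln_power i y * (?h' i - real ((Suc a + (n - Suc i)) choose (n - Suc i)) * h (Suc a + (n - Suc i) + 1) y / y))
      + ln_power n y * ?h' n
    = (\<Sum>i\<le>n. ln_power i y * (real ((a + (n - i)) choose (n - i)) * h (a + (n - i) + 1) y)) / y"
    unfolding lessThan_Suc_atMost[symmetric] sum.lessThan_Suc add_divide_distrib sum_divide_distrib
    by (intro arg_cong2[where f = "(+)"] sum.cong) (use eq in auto)
  ultimately show ?thesis by simp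
qed

text \<open>For \<open>a = 0\<close> all binomial coefficients are 1, so the contributions cancel at
  every power below the top one. There the first entry is 1 and differentiation removes it.\<close>

lemma DERIV_ln_binomial_sum_0:
  assumes "0 < y" and h: "\<And>e. (h (Suc (Suc e)) has_field_derivative h (Suc e) y / y) (at y)"
    and h1: "(h (Suc 0) has_field_derivative d) (at y)"
  shows "((\<lambda>y. \<Sum>i\<le>n. ln_power i y * (real ((0 + (n - i)) choose (n - i)) * h (0 + (n - i) + 1) y))
     has_field_derivative ln_power n y * d) (at y)"
proof -
  let ?h' = "\<lambda>i. if i = n then d else h (n - i) y / y"
  have "((\<lambda>y. \<Sum>i\<le>n. ln_power i y * h (n - i + 1) y) has_field_derivative
     (\<Sum>i<n. ln_power i y * (?h' i - h (n - Suc i + 1) y / y)) + ln_power n y * ?h' n) (at y)"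
  proof (rule DERIV_ln_power_sum[OF assms(1)])
    fix i assume "i \<le> n"
    then show "(h (n - i + 1) has_field_derivative ?h' i) (at y)"
      using h[of "n - i - 1"] h1 by (cases "i = n") (auto simp: Suc_diff_Suc)
  qed
  moreover have "(\<Sum>i<n. ln_power i y * (?h' i - h (n - Suc i + 1) y / y)) = 0"
    by (intro sum.neutral) (auto simp: Suc_diff_Suc)
  ultimately show ?thesis by simp
qed

text \<open>The sum over \<open>j\<^sub>0 + \<dots> + j\<^sub>p = j\<close> of the theorem at
  \<open>y = 1 - x\<close>, with \<open>i\<close> in the role of \<open>j\<^sub>0\<close> and its
  sign absorbed into \<open>ln_power\<close>.\<close>

definition Li_log_sum :: "nat list \<Rightarrow> nat list \<Rightarrow> nat \<Rightarrow> real \<Rightarrow> real" where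
  "Li_log_sum ms k j y = (\<Sum>i\<le>j. ln_power i y * binomial_sum ms (j - i) (\<lambda>v. Li (v @ k) y))"

lemma Li_log_sum_Nil: "Li_log_sum [] k j y = ln_power j y * Li k y"
proof -
  have "Li_log_sum [] k j y = (\<Sum>i\<in>{j}. ln_power i y * Li k y)"
    unfolding Li_log_sum_def by (rule sum.mono_neutral_cong_right) auto
  then show ?thesis by simp
qed

lemma Li_log_sum_Cons:
  "Li_log_sum (a # ms) k j y = (\<Sum>s\<le>j. \<Sum>i\<le>j - s. ln_power i y *
     (real ((a + (j - s - i)) choose (j - s - i)) *
      binomial_sum ms s (\<lambda>v. Li ((a + (j - s - i) + 1) # v @ k) y)))"
  using sum_triangle_swap[of "\<lambda>i b s. ln_power i y * (real ((a + b) choose b) *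
    binomial_sum ms s (\<lambda>v. Li ((a + b + 1) # v @ k) y))" j]
  by (simp add: Li_log_sum_def sum_distrib_left)

lemma DERIV_Li_log_sum_Suc:
  assumes "0 < y" "y < 1"
  shows "(Li_log_sum (Suc a # ms) k j has_field_derivative Li_log_sum (a # ms) k j y / y) (at y)"
  unfolding Li_log_sum_Cons sum_divide_distrib[of _ "{..j}"]
proof (rule DERIV_sum)
  fix s assume "s \<in> {..j}"
  show "((\<lambda>y. \<Sum>i\<le>j - s. ln_power i y * (real ((Suc a + (j - s - i)) choose (j - s - i)) *
           binomial_sum ms s (\<lambda>v. Li ((Suc a + (j - s - i) + 1) # v @ k) y)))
     has_field_derivative (\<Sum>i\<le>j - s. ln_power i y * (real ((a + (j - s - i)) choose (j - s - i)) *
           binomial_sum ms s (\<lambda>v. Li ((a + (j - s - i) + 1) # v @ k) y))) / y) (at y)"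
  proof (rule DERIV_ln_binomial_sum_Suc[OF assms(1), where h = "\<lambda>e y. binomial_sum ms s (\<lambda>v. Li (e # v @ k) y)"])
    show "((\<lambda>y. binomial_sum ms s (\<lambda>v. Li (Suc (Suc e) # v @ k) y)) has_field_derivative
            binomial_sum ms s (\<lambda>v. Li (Suc e # v @ k) y) / y) (at y)" for e
      unfolding binomial_sum_divide[symmetric] by (intro DERIV_binomial_sum DERIV_Li_Suc assms)
  qed
qed

lemma DERIV_Li_log_sum_0:
  assumes "0 < y" "y < 1"
  shows "(Li_log_sum (0 # ms) k j has_field_derivative Li_log_sum ms k j y / (1 - y)) (at y)"
proof -
  have "(Li_log_sum (0 # ms) k j has_field_derivative
      (\<Sum>s\<le>j. ln_power (j - s) y * (binomial_sum ms s (\<lambda>v. Li (v @ k) y) / (1 - y)))) (at y)"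
    unfolding Li_log_sum_Cons
  proof (rule DERIV_sum)
    fix s assume "s \<in> {..j}"
    show "((\<lambda>y. \<Sum>i\<le>j - s. ln_power i y * (real ((0 + (j - s - i)) choose (j - s - i)) *
             binomial_sum ms s (\<lambda>v. Li ((0 + (j - s - i) + 1) # v @ k) y)))
       has_field_derivative ln_power (j - s) y * (binomial_sum ms s (\<lambda>v. Li (v @ k) y) / (1 - y))) (at y)"
    proof (rule DERIV_ln_binomial_sum_0[OF assms(1), where h = "\<lambda>e y. binomial_sum ms s (\<lambda>v. Li (e # v @ k) y)"])
      show "((\<lambda>y. binomial_sum ms s (\<lambda>v. Li (Suc (Suc e) # v @ k) y)) has_field_derivative
              binomial_sum ms s (\<lambda>v. Li (Suc e # v @ k) y) / y) (at y)" for e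
        unfolding binomial_sum_divide[symmetric] by (intro DERIV_binomial_sum DERIV_Li_Suc assms)
      show "((\<lambda>y. binomial_sum ms s (\<lambda>v. Li (Suc 0 # v @ k) y)) has_field_derivative
              binomial_sum ms s (\<lambda>v. Li (v @ k) y) / (1 - y)) (at y)"
        unfolding binomial_sum_divide[symmetric] by (intro DERIV_binomial_sum DERIV_Li_1 assms)
    qed
  qed
  \<comment> \<open>For each \<open>s\<close> only the power \<open>i = j - s\<close> has survived;
    reading the sum by \<open>i\<close> instead gives the shorter list.\<close>
  moreover have "(\<Sum>s\<le>j. ln_power (j - s) y * (binomial_sum ms s (\<lambda>v. Li (v @ k) y) / (1 - y)))
      = Li_log_sum ms k j y / (1 - y)"
    unfolding Li_log_sum_def sum_divide_distrib
    by (rule sum.reindex_bij_witness[of _ "\<lambda>i. j - i" "\<lambda>i. j - i"]) auto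
  ultimately show ?thesis by simp
qed

lemma Li_log_sum_tendsto_0:
  assumes "ms \<noteq> []"
  shows "(Li_log_sum ms k j \<longlongrightarrow> 0) (at_right 0)"
proof -
  obtain a ms' where ms: "ms = a # ms'" using assms by (cases ms) auto
  have *: "((\<lambda>y. ln_power i y * Li (v @ k) y) \<longlongrightarrow> 0) (at_right 0)" if "v \<noteq> []" for v i
  proof -
    have "((\<lambda>y. (- 1) ^ i / fact i * (ln y ^ i * Li (v @ k) y)) \<longlongrightarrow> 0) (at_right 0)"
      using that by (intro tendsto_mult_right_zero Li_tendsto_0) simp
    then show ?thesis by (simp add: power_minus[of "ln _"] mult.assoc)
  qed
  \<comment> \<open>The power of the logarithm is moved inside \<open>binomial_sum\<close>, because
    the limit is known for its product with a polylogarithm. The entry from \<open>a\<close> makes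
    the index nonempty even if \<open>k\<close> is empty.\<close>
  show ?thesis
    unfolding Li_log_sum_def[abs_def] binomial_sum_cmult[symmetric] ms binomial_sum.simps
    by (intro tendsto_null_sum tendsto_mult_right_zero binomial_sum_tendsto_0 *) simp
qed

section \<open>The differential equations\<close>

definition incr_last :: "nat list \<Rightarrow> nat list" where
  "incr_last a = butlast a @ [Suc (last a)]"

text \<open>Hoffman dual of \<open>(m\<^sub>1, m\<^sub>2 + 1, \<dots>, m\<^sub>p + 1)\<close>, computed from the reversed list
  \<open>[m\<^sub>p, \<dots>, m\<^sub>1]\<close>.\<close>

primrec dual_rev :: "nat list \<Rightarrow> nat list" where
  "dual_rev [] = []"
| "dual_rev (a # ms) = (if ms = [] then [] else incr_last (dual_rev ms)) @ replicate a 1"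

lemma is_index_append [simp]: "is_index (a @ b) \<longleftrightarrow> is_index a \<and> is_index b"
  by (auto simp: is_index_def)

lemma is_index_Nil [simp]: "is_index []"
  by (simp add: is_index_def)

lemma is_index_Cons [simp]: "is_index (x # a) \<longleftrightarrow> x > 0 \<and> is_index a"
  by (auto simp: is_index_def)

lemma is_index_incr_last: "is_index a \<Longrightarrow> is_index (incr_last a)"
  by (auto simp: incr_last_def is_index_def dest: in_set_butlastD)

lemma is_index_replicate: "x > 0 \<Longrightarrow> is_index (replicate n x)"
  by (auto simp: is_index_def)

lemma is_index_dual_rev [simp]: "is_index (dual_rev ms)"
  by (induction ms) (auto simp: is_index_replicate is_index_incr_last)

text \<open>The last entry of \<open>ms\<close> is \<open>m\<^sub>1\<close>. Its being positive
  ensures that \<open>incr_last\<close> raises an actual entry, not the unspecified last element of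
  an empty list.\<close>

lemma dual_rev_nonempty: "ms \<noteq> [] \<Longrightarrow> last ms \<ge> 1 \<Longrightarrow> dual_rev ms \<noteq> []"
  by (cases ms) (auto simp: incr_last_def)

lemma dual_rev_Suc: "dual_rev (Suc a # ms) = dual_rev (a # ms) @ [Suc 0]"
  by (simp add: replicate_append_same)

text \<open>The Kaneko--Tsumura part of the right-hand side, without its sign.\<close>

definition mpl_part :: "nat list \<Rightarrow> (nat list \<Rightarrow> nat \<Rightarrow> real) \<Rightarrow> nat list \<Rightarrow> real \<Rightarrow> real" where
  "mpl_part k c ms x = (\<Sum>(k', j)\<in>kt_range k. c k' j * Li_log_sum ms k' j (1 - x))"

text \<open>The last sum of the theorem, indexed by \<open>i = p - j\<close>: \<open>take i\<close>
  gives \<open>m\<^sub>p, \<dots>, m\<^sub>j\<^sub>+\<^sub>1\<close> and \<open>drop i\<close> gives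
  \<open>m\<^sub>j, \<dots>, m\<^sub>1\<close>.\<close>

definition ky_part :: "nat list \<Rightarrow> nat list \<Rightarrow> real \<Rightarrow> real" where
  "ky_part k ms x = (\<Sum>i<length ms. (-1) ^ i * ky_series k (dual_rev (drop i ms)) 1
     * Li (map Suc (take i ms)) (1 - x))"

text \<open>The Kaneko--Tsumura expansion at \<open>y = 1 - x\<close>, with the polylogarithms of
  ones written as powers of the logarithm.\<close>

lemma mpl_part_Nil:
  assumes "kt_coefficients k c" "0 < x" "x < 1"
  shows "mpl_part k c [] x = Li k x"
proof -
  have "Li k (1 - (1 - x)) =
      (\<Sum>(k', j)\<in>kt_range k. c k' j * Li (replicate j 1) (1 - (1 - x)) * Li k' (1 - x))"
    using conjunct2[OF assms(1)[unfolded kt_coefficients_def], rule_format, of "1 - x"] assms(2,3)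
    by linarith
  also have "\<dots> = mpl_part k c [] x"
    unfolding mpl_part_def Li_log_sum_Nil
    using Li_ones[of "1 - x"] assms(2,3) by (intro sum.cong) (auto simp: mult.assoc)
  finally show ?thesis by simp
qed

lemma DERIV_mpl_part_Suc:
  assumes "0 < x" "x < 1"
  shows "(mpl_part k c (Suc a # ms) has_field_derivative - (mpl_part k c (a # ms) x / (1 - x))) (at x)"
  unfolding mpl_part_def sum_divide_distrib sum_negf[symmetric]
  unfolding case_prod_unfold
proof (rule DERIV_sum)
  fix kj :: "nat list \<times> nat"
  let ?k = "fst kj" and ?j = "snd kj"
  show "((\<lambda>x. c ?k ?j * Li_log_sum (Suc a # ms) ?k ?j (1 - x)) has_field_derivative
      - (c ?k ?j * Li_log_sum (a # ms) ?k ?j (1 - x) / (1 - x))) (at x)"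
    by (rule DERIV_cong[OF DERIV_cmult[OF DERIV_comp_1_minus[OF DERIV_Li_log_sum_Suc]]])
       (use assms in auto)
qed

lemma DERIV_mpl_part_0:
  assumes "0 < x" "x < 1"
  shows "(mpl_part k c (0 # ms) has_field_derivative - (mpl_part k c ms x / x)) (at x)"
  unfolding mpl_part_def sum_divide_distrib sum_negf[symmetric]
  unfolding case_prod_unfold
proof (rule DERIV_sum)
  fix kj :: "nat list \<times> nat"
  let ?k = "fst kj" and ?j = "snd kj"
  show "((\<lambda>x. c ?k ?j * Li_log_sum (0 # ms) ?k ?j (1 - x)) has_field_derivative
      - (c ?k ?j * Li_log_sum ms ?k ?j (1 - x) / x)) (at x)"
    by (rule DERIV_cong[OF DERIV_cmult[OF DERIV_comp_1_minus[OF DERIV_Li_log_sum_0]]])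
       (use assms in auto)
qed

lemma filterlim_1_minus: "filterlim (\<lambda>x::real. 1 - x) (at_right 0) (at_left 1)"
  by real_asymp

lemma mpl_part_tendsto_0:
  assumes "ms \<noteq> []"
  shows "(mpl_part k c ms \<longlongrightarrow> 0) (at_left 1)"
  unfolding mpl_part_def case_prod_unfold
  by (intro tendsto_null_sum tendsto_mult_right_zero
       filterlim_compose[OF Li_log_sum_tendsto_0[OF assms] filterlim_1_minus])

text \<open>Separates the constant term \<open>i = 0\<close> from the others, whose polylogarithms
  all begin with \<open>Suc a\<close>; only these contribute to the derivative, and they vanish as
  \<open>x\<close> tends to 1.\<close>

lemma ky_part_Cons:
  "ky_part k (a # ms) x = ky_series k (dual_rev (a # ms)) 1
     - (\<Sum>i<length ms. (-1) ^ i * ky_series k (dual_rev (drop i ms)) 1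
          * Li (Suc a # map Suc (take i ms)) (1 - x))"
  unfolding ky_part_def list.size(4) add_Suc_right add_0_right sum.lessThan_Suc_shift
  by (simp add: sum_negf del: dual_rev.simps)

lemma DERIV_ky_part_Suc:
  assumes "0 < x" "x < 1"
  shows "(ky_part k (Suc a # ms) has_field_derivative
      (ky_series k (dual_rev (a # ms)) 1 - ky_part k (a # ms) x) / (1 - x)) (at x)"
proof -
  have "((\<lambda>x. ky_series k (dual_rev (Suc a # ms)) 1
     - (\<Sum>i<length ms. (-1) ^ i * ky_series k (dual_rev (drop i ms)) 1
          * Li (Suc (Suc a) # map Suc (take i ms)) (1 - x))) has_field_derivative
     0 - (\<Sum>i<length ms. (-1) ^ i * ky_series k (dual_rev (drop i ms)) 1
          * - (Li (Suc a # map Suc (take i ms)) (1 - x) / (1 - x)))) (at x)"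
    using assms by (intro DERIV_diff DERIV_const DERIV_sum DERIV_cmult
          DERIV_comp_1_minus[OF DERIV_Li_Suc]) auto
  then show ?thesis
    unfolding ky_part_Cons by (simp add: sum_negf sum_divide_distrib del: dual_rev.simps)
qed

lemma DERIV_ky_part_0:
  assumes "0 < x" "x < 1"
  shows "(ky_part k (0 # ms) has_field_derivative ky_part k ms x / x) (at x)"
proof -
  have "((\<lambda>x. ky_series k (dual_rev (0 # ms)) 1
     - (\<Sum>i<length ms. (-1) ^ i * ky_series k (dual_rev (drop i ms)) 1
          * Li (Suc 0 # map Suc (take i ms)) (1 - x))) has_field_derivative
     0 - (\<Sum>i<length ms. (-1) ^ i * ky_series k (dual_rev (drop i ms)) 1
          * - (Li (map Suc (take i ms)) (1 - x) / (1 - (1 - x))))) (at x)"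
    using assms by (intro DERIV_diff DERIV_const DERIV_sum DERIV_cmult
          DERIV_comp_1_minus[OF DERIV_Li_1]) auto
  then show ?thesis
    unfolding ky_part_Cons by (simp add: sum_negf sum_divide_distrib ky_part_def del: dual_rev.simps)
qed

lemma ky_part_tendsto:
  assumes "ms \<noteq> []"
  shows "(ky_part k ms \<longlongrightarrow> ky_series k (dual_rev ms) 1) (at_left 1)"
proof -
  obtain a ms' where ms: "ms = a # ms'" using assms by (cases ms) auto
  have "((\<lambda>x. Li (Suc a # v) (1 - x)) \<longlongrightarrow> 0) (at_left 1)" for v
    using filterlim_compose[OF Li_tendsto_0[of "Suc a # v" 0] filterlim_1_minus] by simp
  then have "(ky_part k ms \<longlongrightarrow> ky_series k (dual_rev ms) 1 - 0) (at_left 1)"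
    unfolding ms ky_part_Cons[abs_def]
    by (intro tendsto_diff tendsto_const tendsto_null_sum tendsto_mult_right_zero)
  then show ?thesis by simp
qed

lemma eq_if_same_DERIV:
  fixes f g :: "real \<Rightarrow> real"
  assumes f: "\<And>z. 0 < z \<Longrightarrow> z < 1 \<Longrightarrow> (f has_field_derivative f' z) (at z)"
    and g: "\<And>z. 0 < z \<Longrightarrow> z < 1 \<Longrightarrow> (g has_field_derivative f' z) (at z)"
    and lim: "(f \<longlongrightarrow> l) (at_left 1)" "(g \<longlongrightarrow> l) (at_left 1)" and y: "0 < y" "y < 1"
  shows "f y = g y"
proof -
  have "(\<lambda>z. f z - g z) y = 0"
  proof (rule zero_if_DERIV_zero[of "\<lambda>z. f z - g z", OF _ _ y])
    show "((\<lambda>z. f z - g z) has_field_derivative 0) (at z)" if "0 < z" "z < 1" for z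
      using DERIV_diff[OF f[OF that] g[OF that]] by simp
    show "((\<lambda>z. f z - g z) \<longlongrightarrow> 0) (at_left 1)"
      using tendsto_diff[OF lim] by simp
  qed
  then show ?thesis by simp
qed

text \<open>The list \<open>[0]\<close>, with empty dual, is included as the base of the induction.\<close>

theorem ky_series_eq:
  assumes k: "is_index k" "k \<noteq> []" and c: "kt_coefficients k c"
    and "ms \<noteq> []" "length ms = 1 \<or> last ms \<ge> 1" "0 < x" "x < 1"
  shows "ky_series k (dual_rev ms) x = (-1) ^ length ms * mpl_part k c ms x + ky_part k ms x"
  using assms(4-)
proof (induction ms arbitrary: x)
  case (Cons a ms)
  let ?R = "\<lambda>ms x. (-1) ^ length ms * mpl_part k c ms x + ky_part k ms x"
  have lim: "(?R ms \<longlongrightarrow> ky_series k (dual_rev ms) 1) (at_left 1)" if "ms \<noteq> []" for ms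
    using tendsto_add[OF tendsto_mult_right_zero[OF mpl_part_tendsto_0[OF that]] ky_part_tendsto[OF that]]
    by simp
  have ms: "ms = [] \<or> last ms \<ge> 1" using Cons.prems by (auto split: if_splits)
  \<comment> \<open>The outer induction removes the first entry and the inner one lowers it by 1.
    Only the bounds on \<open>x\<close> are carried along, so the inner induction may pass through
    the list \<open>[0]\<close>.\<close>
  show ?case using Cons.prems(3,4)
  proof (induction a arbitrary: x)
    case 0
    \<comment> \<open>Removing an entry flips the sign \<open>(-1) ^ length ms\<close>, which
      cancels the minus sign from differentiating at \<open>1 - x\<close>.\<close>
    have "(?R (0 # ms) has_field_derivative ?R ms z / z) (at z)" if "0 < z" "z < 1" for z
      using DERIV_add[OF DERIV_cmult[OF DERIV_mpl_part_0[OF that]] DERIV_ky_part_0[OF that]]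
      by (rule DERIV_cong) (simp add: add_divide_distrib)
    moreover have "(ky_series k (dual_rev (0 # ms)) has_field_derivative ?R ms z / z) (at z)"
      if z: "0 < z" "z < 1" for z
    proof (cases "ms = []")
      case True
      then show ?thesis
        using DERIV_ky_series_Nil[OF k z] by (simp add: mpl_part_Nil[OF c z] ky_part_def)
    next
      case False
      then have "dual_rev ms \<noteq> []" using ms by (intro dual_rev_nonempty) auto
      then have d: "dual_rev ms = butlast (dual_rev ms) @ [last (dual_rev ms)]" by simp
      have "(ky_series k (dual_rev (0 # ms)) has_field_derivative ky_series k (dual_rev ms) z / z) (at z)"
        using DERIV_ky_series_snoc_Suc[OF k _ z, of "butlast (dual_rev ms)" "last (dual_rev ms)"] False
        by (simp add: d[symmetric] incr_last_def)
      moreover have "ky_series k (dual_rev ms) z = ?R ms z"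
        using Cons.IH[OF False _ z] ms False by simp
      ultimately show ?thesis by simp
    qed
    ultimately show ?case
      by (intro eq_if_same_DERIV[OF _ _ ky_tendsto[OF k is_index_dual_rev] lim 0(1,2)]) auto
  next
    case (Suc a)
    let ?d = "\<lambda>z. (ky_series k (dual_rev (a # ms)) 1 - ky_series k (dual_rev (a # ms)) z) / (1 - z)"
    \<comment> \<open>The inner induction hypothesis replaces the right-hand side for
      \<open>a # ms\<close> by the series, which puts the derivative into the form of
      \<open>DERIV_ky_series_snoc_1\<close>.\<close>
    have "(?R (Suc a # ms) has_field_derivative ?d z) (at z)" if "0 < z" "z < 1" for z
      using DERIV_add[OF DERIV_cmult[OF DERIV_mpl_part_Suc[OF that]] DERIV_ky_part_Suc[OF that]]
      by (rule DERIV_cong)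
         (simp add: Suc.IH[OF that] diff_divide_distrib add_divide_distrib del: dual_rev.simps)
    moreover have "(ky_series k (dual_rev (Suc a # ms)) has_field_derivative ?d z) (at z)"
      if "0 < z" "z < 1" for z
      unfolding dual_rev_Suc by (rule DERIV_ky_series_snoc_1[OF k is_index_dual_rev that])
    ultimately show ?case
      by (intro eq_if_same_DERIV[OF _ _ ky_tendsto[OF k is_index_dual_rev] lim Suc.prems(1,2)]) auto
  qed
qed simp

section \<open>Hoffman duals and compositions\<close>

lemma sum_list_pos_if_index: "is_index a \<Longrightarrow> a \<noteq> [] \<Longrightarrow> sum_list a > 0"
  by (cases a) auto

lemma proper_partial_sums_image:
  "proper_partial_sums a = (\<lambda>i. sum_list (take i a)) ` {1..<length a}"
  by (auto simp: proper_partial_sums_def)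

lemma proper_partial_sums_Nil [simp]: "proper_partial_sums [] = {}"
  by (simp add: proper_partial_sums_def)

lemma proper_partial_sums_snoc:
  "proper_partial_sums (a @ [b]) = (if a = [] then {} else insert (sum_list a) (proper_partial_sums a))"
proof (cases "a = []")
  case False
  then have "{1..<length (a @ [b])} = insert (length a) {1..<length a}" by (auto simp: Suc_le_eq)
  then have "proper_partial_sums (a @ [b]) =
      insert (sum_list a) ((\<lambda>i. sum_list (take i (a @ [b]))) ` {1..<length a})"
    by (simp add: proper_partial_sums_image)
  also have "(\<lambda>i. sum_list (take i (a @ [b]))) ` {1..<length a} = proper_partial_sums a"
    unfolding proper_partial_sums_image by (intro image_cong) auto
  finally show ?thesis using False by simp
qed (simp add: proper_partial_sums_def)

lemma proper_partial_sums_less: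
  assumes "is_index a" "t \<in> proper_partial_sums a"
  shows "t < sum_list a"
proof -
  obtain i where i: "t = sum_list (take i a)" "i < length a"
    using assms(2) by (auto simp: proper_partial_sums_def)
  have "is_index (drop i a)" using assms(1) by (metis append_take_drop_id is_index_append)
  then have "sum_list (drop i a) > 0" using i by (intro sum_list_pos_if_index) auto
  moreover have "sum_list a = sum_list (take i a) + sum_list (drop i a)"
    by (metis append_take_drop_id sum_list_append)
  ultimately show ?thesis using i by simp
qed

text \<open>The largest proper partial sum is the weight without the last entry. This gives equality
  of the initial segments by induction, and the total weight then fixes the last entry.\<close>

lemma index_eqI:
  assumes "is_index a" "is_index b" "sum_list a = sum_list b"
    and "proper_partial_sums a = proper_partial_sums b"
  shows "a = b"
  using assms
proof (induction a arbitrary: b rule: rev_induct)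
  case Nil
  then have "\<not> sum_list b > 0" by simp
  then show ?case using sum_list_pos_if_index[of b] Nil.prems(2) by metis
next
  case (snoc x a)
  have pos: "x > 0" "is_index a" using snoc.prems(1) by auto
  then have "sum_list b > 0" using snoc.prems(3) by simp
  then have "b \<noteq> []" by auto
  then obtain b' y where b: "b = b' @ [y]" by (cases b rule: rev_cases) auto
  have pos': "is_index b'" using snoc.prems(2) by (simp add: b)
  note eq = snoc.prems(4)[unfolded b proper_partial_sums_snoc]
  have "a = b'"
  proof (cases "a = [] \<or> b' = []")
    case True
    then show ?thesis using eq by (cases "a = []"; cases "b' = []") simp_all
  next
    case False
    with eq have eq: "insert (sum_list a) (proper_partial_sums a) = insert (sum_list b') (proper_partial_sums b')"
      by simp
    note less = proper_partial_sums_less[OF pos(2)]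
    note less' = proper_partial_sums_less[OF pos']
    have "sum_list a \<in> insert (sum_list b') (proper_partial_sums b')" using eq by blast
    then have "sum_list a \<le> sum_list b'" using less'[of "sum_list a"] by auto
    moreover have "sum_list b' \<in> insert (sum_list a) (proper_partial_sums a)" using eq by blast
    then have "sum_list b' \<le> sum_list a" using less[of "sum_list b'"] by auto
    ultimately have s: "sum_list a = sum_list b'" by simp
    have "sum_list b' \<notin> proper_partial_sums a" "sum_list b' \<notin> proper_partial_sums b'"
      using less less' s by fastforce+
    then have "proper_partial_sums a = proper_partial_sums b'"
      using eq unfolding s by (simp add: insert_ident)
    then show ?thesis by (rule snoc.IH[OF pos(2) pos' s])
  qed
  then show ?case using snoc.prems(3) by (simp add: b)
qed

lemma hoffman_dual_eqI:
  assumes "is_index b" "sum_list b = sum_list a"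
    and "proper_partial_sums a \<union> proper_partial_sums b = {1..<sum_list a}"
    and "proper_partial_sums a \<inter> proper_partial_sums b = {}"
  shows "hoffman_dual a = b"
  unfolding hoffman_dual_def
proof (rule the_equality)
  fix b' assume b': "is_index b' \<and> sum_list b' = sum_list a \<and>
     proper_partial_sums a \<union> proper_partial_sums b' = {1..<sum_list a} \<and>
     proper_partial_sums a \<inter> proper_partial_sums b' = {}"
  then have "proper_partial_sums b' = proper_partial_sums b" using assms(3,4) by blast
  then show "b' = b" using b' assms by (intro index_eqI) auto
qed (use assms in blast)

text \<open>Follows the recursion of \<open>dual_rev\<close>, so that both indices can be compared
  entry by entry.\<close>

primrec m_index_rev :: "nat list \<Rightarrow> nat list" where
  "m_index_rev [] = []"
| "m_index_rev (a # ms) = (if ms = [] then [a] else m_index_rev ms @ [Suc a])"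

lemma m_index_eq_rev: "j \<ge> 1 \<Longrightarrow> m_index m j = m_index_rev (map m (rev [1..<Suc j]))"
proof (induction j rule: dec_induct)
  case (step j)
  have "m_index m (Suc j) = m_index m j @ [Suc (m (Suc j))]"
    using step.hyps by (simp add: m_index_def)
  also have "\<dots> = m_index_rev (m (Suc j) # map m (rev [1..<Suc j]))"
    using step by simp
  also have "m (Suc j) # map m (rev [1..<Suc j]) = map m (rev [1..<Suc (Suc j)])"
    by simp
  finally show ?case .
qed (simp add: m_index_def)

lemma proper_partial_sums_append_ones:
  assumes "a \<noteq> []"
  shows "proper_partial_sums (a @ replicate n 1) = proper_partial_sums a \<union> {sum_list a..<sum_list a + n}"
proof (induction n)
  case (Suc n)
  have "a @ replicate (Suc n) 1 = (a @ replicate n 1) @ [1]"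
    by (simp add: replicate_append_same)
  then have "proper_partial_sums (a @ replicate (Suc n) 1) =
      insert (sum_list a + n) (proper_partial_sums (a @ replicate n 1))"
    using assms by (simp only: proper_partial_sums_snoc) (simp add: sum_list_replicate)
  also have "\<dots> = proper_partial_sums a \<union> insert (sum_list a + n) {sum_list a..<sum_list a + n}"
    unfolding Suc.IH by simp
  also have "insert (sum_list a + n) {sum_list a..<sum_list a + n} = {sum_list a..<sum_list a + Suc n}"
    by auto
  finally show ?case .
qed simp

lemma incr_last_snoc [simp]: "incr_last (a @ [b]) = a @ [Suc b]"
  by (simp add: incr_last_def)

text \<open>Let \<open>w\<close> be the weight so far. Appending \<open>Suc a\<close> makes
  \<open>w\<close> a partial sum of the index; on the dual side raising the last entry skips
  \<open>w\<close>, and the \<open>a\<close> appended ones contribute exactly the partial sums from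
  \<open>w + 1\<close> to \<open>w + a\<close>.\<close>

lemma m_index_rev_dual:
  assumes "ms \<noteq> []" "last ms \<ge> 1"
  shows "sum_list (dual_rev ms) = sum_list (m_index_rev ms) \<and>
    proper_partial_sums (m_index_rev ms) \<union> proper_partial_sums (dual_rev ms) = {1..<sum_list (m_index_rev ms)} \<and>
    proper_partial_sums (m_index_rev ms) \<inter> proper_partial_sums (dual_rev ms) = {}"
  using assms
proof (induction ms)
  case (Cons a ms)
  show ?case
  proof (cases "ms = []")
    case True
    then obtain b where a: "a = Suc b" using Cons.prems by (cases a) auto
    have "proper_partial_sums (replicate a 1) = {1..<a}"
      using proper_partial_sums_append_ones[of "[1]" b] proper_partial_sums_snoc[of "[]" 1] by (simp add: a)
    then show ?thesis using True proper_partial_sums_snoc[of "[]" a]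
      by (simp add: sum_list_replicate)
  next
    case False
    define w where "w = sum_list (m_index_rev ms)"
    let ?M = "proper_partial_sums (m_index_rev ms)"
    let ?D = "proper_partial_sums (dual_rev ms)"
    have IH: "sum_list (dual_rev ms) = w" "?M \<union> ?D = {1..<w}" "?M \<inter> ?D = {}"
      using Cons False by (auto simp: w_def)
    have ne: "dual_rev ms \<noteq> []" using Cons.prems False by (intro dual_rev_nonempty) auto
    then obtain d e where de: "dual_rev ms = d @ [e]" by (metis append_butlast_last_id)
    have "w > 0" using IH(1) sum_list_pos_if_index[OF is_index_dual_rev ne] by simp
    have M_ne: "m_index_rev ms \<noteq> []" using False by (cases ms) auto
    have M': "proper_partial_sums (m_index_rev (a # ms)) = insert w ?M"
      using False M_ne by (simp add: proper_partial_sums_snoc w_def)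
    have "proper_partial_sums (dual_rev (a # ms)) =
        proper_partial_sums (d @ [Suc e]) \<union> {sum_list (d @ [Suc e])..<sum_list (d @ [Suc e]) + a}"
      using False proper_partial_sums_append_ones[of "d @ [Suc e]" a] by (simp add: de)
    also have "proper_partial_sums (d @ [Suc e]) = ?D" by (simp add: de proper_partial_sums_snoc)
    also have s: "sum_list (d @ [Suc e]) = Suc w" using IH(1) by (simp add: de)
    finally have D': "proper_partial_sums (dual_rev (a # ms)) = ?D \<union> {Suc w..<Suc w + a}" .
    have S: "sum_list (m_index_rev (a # ms)) = Suc w + a" using False by (simp add: w_def)
    have S': "sum_list (dual_rev (a # ms)) = Suc w + a"
      using False s by (simp add: de sum_list_replicate)
    have sub: "?M \<subseteq> {1..<w}" "?D \<subseteq> {1..<w}" using IH(2) by auto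
    have "insert w ?M \<union> (?D \<union> {Suc w..<Suc w + a}) = insert w ({1..<w} \<union> {Suc w..<Suc w + a})"
      using IH(2) by blast
    also have "\<dots> = {1..<Suc w + a}" using \<open>w > 0\<close> by auto
    finally have U: "insert w ?M \<union> (?D \<union> {Suc w..<Suc w + a}) = {1..<Suc w + a}" .
    have I: "insert w ?M \<inter> (?D \<union> {Suc w..<Suc w + a}) = {}"
      using IH(3) subsetD[OF sub(1)] subsetD[OF sub(2)] by fastforce
    show ?thesis unfolding S S' M' D' using U I by blast
  qed
qed simp

lemma hoffman_dual_m_index:
  assumes "j \<ge> 1" "m 1 \<ge> 1"
  shows "hoffman_dual (m_index m j) = dual_rev (map m (rev [1..<Suc j]))"
proof -
  have "map m (rev [1..<Suc j]) \<noteq> []" using assms by simp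
  moreover have "last (map m (rev [1..<Suc j])) \<ge> 1"
    using assms by (simp add: last_map last_rev hd_upt del: upt_Suc)
  ultimately show ?thesis
    unfolding m_index_eq_rev[OF assms(1)] using m_index_rev_dual by (intro hoffman_dual_eqI) auto
qed

section \<open>Sums over compositions\<close>

lemma finite_length_sum_list: "finite {js :: nat list. length js = p \<and> sum_list js = s}"
  by (rule finite_subset[OF _ finite_lists_length_eq[of "{..s}" p]])
     (auto dest: member_le_sum_list)

text \<open>Splits off \<open>j\<^sub>p\<close>, which belongs to the head \<open>m\<^sub>p\<close>
  of the reversed list.\<close>

lemma sum_compositions_snoc:
  fixes f :: "nat list \<Rightarrow> real"
  shows "(\<Sum>js | length js = Suc p \<and> sum_list js = s. f js) =
    (\<Sum>b\<le>s. \<Sum>js | length js = p \<and> sum_list js = s - b. f (js @ [b]))"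
proof -
  have "(\<Sum>b\<le>s. \<Sum>js | length js = p \<and> sum_list js = s - b. f (js @ [b])) =
    (\<Sum>(b, js)\<in>(SIGMA b:{..s}. {js. length js = p \<and> sum_list js = s - b}). f (js @ [b]))"
    by (intro sum.Sigma) (auto simp: finite_length_sum_list)
  also have "\<dots> = (\<Sum>js | length js = Suc p \<and> sum_list js = s. f js)"
  proof (rule sum.reindex_bij_witness[of _ "\<lambda>js. (last js, butlast js)" "\<lambda>(b, js). js @ [b]"])
    fix js :: "nat list" assume js: "js \<in> {js. length js = Suc p \<and> sum_list js = s}"
    then have d: "js = butlast js @ [last js]" by (cases js) auto
    have "sum_list js = sum_list (butlast js) + last js" by (subst d) simp
    then show "(last js, butlast js) \<in> (SIGMA b:{..s}. {js. length js = p \<and> sum_list js = s - b})"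
      using js by auto
    show "(case (last js, butlast js) of (b, js) \<Rightarrow> js @ [b]) = js" using d by simp
  qed auto
  finally show ?thesis by simp
qed

text \<open>Splits off \<open>j\<^sub>0\<close>, the exponent of the logarithm.\<close>

lemma sum_compositions_Cons:
  fixes f :: "nat list \<Rightarrow> real"
  shows "(\<Sum>js | length js = Suc p \<and> sum_list js = s. f js) =
    (\<Sum>b\<le>s. \<Sum>js | length js = p \<and> sum_list js = s - b. f (b # js))"
proof -
  have "(\<Sum>b\<le>s. \<Sum>js | length js = p \<and> sum_list js = s - b. f (b # js)) =
    (\<Sum>(b, js)\<in>(SIGMA b:{..s}. {js. length js = p \<and> sum_list js = s - b}). f (b # js))"
    by (intro sum.Sigma) (auto simp: finite_length_sum_list)
  also have "\<dots> = (\<Sum>js | length js = Suc p \<and> sum_list js = s. f js)"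
    by (rule sum.reindex_bij_witness[of _ "\<lambda>js. (hd js, tl js)" "\<lambda>(b, js). b # js"])
       (auto simp: length_Suc_conv)
  finally show ?thesis by simp
qed

text \<open>Here \<open>js\<close> lists \<open>j\<^sub>1, \<dots>, j\<^sub>p\<close> from position
  0, hence the offset \<open>l - 1\<close>; it disappears once \<open>j\<^sub>0\<close> is put in
  front.\<close>

lemma binomial_sum_compositions:
  "binomial_sum (map m (rev [1..<Suc p])) s f =
     (\<Sum>js | length js = p \<and> sum_list js = s.
        (\<Prod>l=1..p. real ((m l + js ! (l - 1)) choose (js ! (l - 1))))
        * f (map (\<lambda>l. m l + js ! (l - 1) + 1) (rev [1..<Suc p])))"
proof (induction p arbitrary: s f)
  case 0
  have "{js :: nat list. length js = 0 \<and> sum_list js = s} = (if s = 0 then {[]} else {})" by auto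
  then show ?case by simp
next
  case (Suc p)
  have map_rev: "map g (rev [1..<Suc (Suc p)]) = g (Suc p) # map g (rev [1..<Suc p])" for g :: "nat \<Rightarrow> nat"
    by simp
  have *: "(\<Prod>l=1..Suc p. real ((m l + (js @ [b]) ! (l - 1)) choose ((js @ [b]) ! (l - 1))))
        * f (map (\<lambda>l. m l + (js @ [b]) ! (l - 1) + 1) (rev [1..<Suc (Suc p)])) =
      real ((m (Suc p) + b) choose b) * ((\<Prod>l=1..p. real ((m l + js ! (l - 1)) choose (js ! (l - 1))))
        * f ((m (Suc p) + b + 1) # map (\<lambda>l. m l + js ! (l - 1) + 1) (rev [1..<Suc p])))"
    if "length js = p" for js b
  proof -
    have e1: "(\<Prod>l=1..p. real ((m l + (js @ [b]) ! (l - 1)) choose ((js @ [b]) ! (l - 1)))) =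
        (\<Prod>l=1..p. real ((m l + js ! (l - 1)) choose (js ! (l - 1))))"
      using that by (intro prod.cong) (auto simp: nth_append)
    have e2: "map (\<lambda>l. m l + (js @ [b]) ! (l - 1) + 1) (rev [1..<Suc p]) =
        map (\<lambda>l. m l + js ! (l - 1) + 1) (rev [1..<Suc p])"
      using that by (intro map_cong) (auto simp: nth_append)
    have e3: "(js @ [b]) ! (Suc p - 1) = b" using that by (simp add: nth_append)
    have P: "(\<Prod>l=1..Suc p. g l) = g (Suc p) * (\<Prod>l=1..p. g l)" for g :: "nat \<Rightarrow> real"
      by simp
    show ?thesis unfolding map_rev P e1 e2 e3 by (rule mult.assoc)
  qed
  have "binomial_sum (map m (rev [1..<Suc (Suc p)])) s f =
     (\<Sum>b\<le>s. \<Sum>js | length js = p \<and> sum_list js = s - b.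
      real ((m (Suc p) + b) choose b) * ((\<Prod>l=1..p. real ((m l + js ! (l - 1)) choose (js ! (l - 1))))
        * f ((m (Suc p) + b + 1) # map (\<lambda>l. m l + js ! (l - 1) + 1) (rev [1..<Suc p]))))"
    unfolding map_rev binomial_sum.simps Suc.IH sum_distrib_left ..
  also have "\<dots> = (\<Sum>js | length js = Suc p \<and> sum_list js = s.
        (\<Prod>l=1..Suc p. real ((m l + js ! (l - 1)) choose (js ! (l - 1))))
        * f (map (\<lambda>l. m l + js ! (l - 1) + 1) (rev [1..<Suc (Suc p)])))"
    unfolding sum_compositions_snoc by (intro sum.cong refl) (use * in auto)
  finally show ?case .
qed

lemma Li_log_sum_compositions:
  assumes "0 < y"
  shows "Li_log_sum (map m (rev [1..<Suc p])) k j y =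
    (\<Sum>js | length js = p + 1 \<and> sum_list js = j.
             (-1) ^ (js ! 0) / fact (js ! 0)
             * (\<Prod>l=1..p. real ((m l + js ! l) choose (js ! l)))
             * ln y ^ (js ! 0)
             * Li (map (\<lambda>l. m l + js ! l + 1) (rev [1..<Suc p]) @ k) y)"
proof -
  have *: "(-1) ^ ((i # js) ! 0) / fact ((i # js) ! 0)
             * (\<Prod>l=1..p. real ((m l + (i # js) ! l) choose ((i # js) ! l)))
             * ln y ^ ((i # js) ! 0)
             * Li (map (\<lambda>l. m l + (i # js) ! l + 1) (rev [1..<Suc p]) @ k) y
    = ln_power i y * ((\<Prod>l=1..p. real ((m l + js ! (l - 1)) choose (js ! (l - 1))))
        * Li (map (\<lambda>l. m l + js ! (l - 1) + 1) (rev [1..<Suc p]) @ k) y)" for i js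
  proof -
    have e1: "map (\<lambda>l. m l + (i # js) ! l + 1) (rev [1..<Suc p]) =
        map (\<lambda>l. m l + js ! (l - 1) + 1) (rev [1..<Suc p])"
      by (intro map_cong) (auto simp: nth_Cons')
    have e2: "(\<Prod>l=1..p. real ((m l + (i # js) ! l) choose ((i # js) ! l))) =
        (\<Prod>l=1..p. real ((m l + js ! (l - 1)) choose (js ! (l - 1))))"
      by (intro prod.cong) (auto simp: nth_Cons')
    show ?thesis unfolding e1 e2 nth_Cons_0 by (simp add: power_minus[of "ln y"] del: upt_Suc)
  qed
  show ?thesis
    unfolding Suc_eq_plus1[symmetric, of p] sum_compositions_Cons *
    unfolding Li_log_sum_def binomial_sum_compositions sum_distrib_left ..
qed

section \<open>Kaneko--Yamamoto values and the final formula\<close>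

lemma ky_series_1:
  assumes "is_index k" "k \<noteq> []" "is_index a"
  shows "kaneko_yamamoto k (1 # a) = ky_series k a 1"
proof -
  have "((\<lambda>n. ky_weight k n * star_poly a n 1) has_sum ky_series k a 1) UNIV"
    using ky_sums[OF assms, of 1]
    by (intro sums_nonneg_imp_has_sum) (auto simp: ky_weight_nonneg star_poly_nonneg)
  then have "((\<lambda>n. ky_weight k n * star_poly a n 1) has_sum ky_series k a 1) {1..}"
    by (subst (asm) has_sum_cong_neutral[where T = "{1..}" and g = "\<lambda>n. ky_weight k n * star_poly a n 1"])
       (auto simp: not_le)
  from infsumI[OF this] show ?thesis
    by (simp add: kaneko_yamamoto_def ky_weight_def mhs_star_eq)
qed

lemma take_rev_upt: "i \<le> p \<Longrightarrow> take i (rev [1..<Suc p]) = rev [Suc (p - i)..<Suc p]"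
  by (simp add: take_rev drop_upt del: upt_Suc)

lemma drop_rev_upt: "drop i (rev [1..<Suc p]) = rev [1..<Suc (p - i)]" if "i \<le> p"
  using that by (simp add: drop_rev take_upt Suc_diff_le del: upt_Suc)

text \<open>Substitutes \<open>j = p - i\<close>: the list left after dropping \<open>i\<close>
  entries belongs to \<open>m_index m j\<close>, and its \<open>dual_rev\<close> is the Hoffman
  dual.\<close>

lemma ky_part_upt:
  assumes "is_index k" "k \<noteq> []" "m 1 \<ge> 1"
  shows "ky_part k (map m (rev [1..<Suc p])) x = (\<Sum>j=1..p. (-1) ^ (p - j)
             * kaneko_yamamoto k (1 # hoffman_dual (m_index m j))
             * Li (map (\<lambda>l. m l + 1) (rev [Suc j..<Suc p])) (1 - x))"
proof -
  let ?ms = "map m (rev [1..<Suc p])"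
  have "ky_part k ?ms x = (\<Sum>i<p. (-1) ^ i * ky_series k (dual_rev (drop i ?ms)) 1
     * Li (map Suc (take i ?ms)) (1 - x))"
    by (simp add: ky_part_def del: upt_Suc)
  also have "\<dots> = (\<Sum>j=1..p. (-1) ^ (p - j)
             * kaneko_yamamoto k (1 # hoffman_dual (m_index m j))
             * Li (map (\<lambda>l. m l + 1) (rev [Suc j..<Suc p])) (1 - x))"
  proof (rule sum.reindex_bij_witness[of _ "\<lambda>j. p - j" "\<lambda>i. p - i"])
    fix i assume i: "i \<in> {..<p}"
    have "dual_rev (drop i ?ms) = hoffman_dual (m_index m (p - i))"
      unfolding drop_map using i assms(3) by (subst drop_rev_upt) (auto simp: hoffman_dual_m_index)
    moreover have "is_index (hoffman_dual (m_index m (p - i)))"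
      using i assms(3) by (subst hoffman_dual_m_index) auto
    moreover have "map Suc (take i ?ms) = map (\<lambda>l. m l + 1) (rev [Suc (p - i)..<Suc p])"
      unfolding take_map using i by (subst take_rev_upt) auto
    ultimately show "(-1) ^ (p - (p - i)) * kaneko_yamamoto k (1 # hoffman_dual (m_index m (p - i)))
             * Li (map (\<lambda>l. m l + 1) (rev [Suc (p - i)..<Suc p])) (1 - x) =
        (-1) ^ i * ky_series k (dual_rev (drop i ?ms)) 1 * Li (map Suc (take i ?ms)) (1 - x)"
      using i ky_series_1[OF assms(1,2)] by simp
  qed auto
  finally show ?thesis .
qed

theorem theorem3p1:
  fixes p :: nat and m :: "nat \<Rightarrow> nat" and k :: "nat list" and x :: real
    and c :: "nat list \<Rightarrow> nat \<Rightarrow> real"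
  assumes "p \<ge> 1" and "m 1 \<ge> 1"
    and "is_index k" and "k \<noteq> []"
    and "0 < x" and "x < 1"
    and "kt_coefficients k c"
  shows "((\<lambda>n. mhs (n - 1) (tl k) * mhs_star_param n (hoffman_dual (m_index m p)) x
              / real n ^ (hd k + 1))
     has_sum
       ((-1) ^ p * (\<Sum>(k', j)\<in>kt_range k. c k' j *
          (\<Sum>js | length js = p + 1 \<and> sum_list js = j.
             (-1) ^ (js ! 0) / fact (js ! 0)
             * (\<Prod>l=1..p. real ((m l + js ! l) choose (js ! l)))
             * ln (1 - x) ^ (js ! 0)
             * Li (map (\<lambda>l. m l + js ! l + 1) (rev [1..<Suc p]) @ k') (1 - x)))
        + (\<Sum>j=1..p. (-1) ^ (p - j)
             * kaneko_yamamoto k (1 # hoffman_dual (m_index m j))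
             * Li (map (\<lambda>l. m l + 1) (rev [Suc j..<Suc p])) (1 - x)))) {1..}"
proof -
  let ?ms = "map m (rev [1..<Suc p])"
  have ms: "?ms \<noteq> []" "last ?ms \<ge> 1"
    using assms(1,2) by (simp_all add: last_map last_rev hd_upt del: upt_Suc)
  have dual: "hoffman_dual (m_index m p) = dual_rev ?ms"
    using assms(1,2) by (rule hoffman_dual_m_index)
  \<comment> \<open>Nonnegativity turns the ordered series into an unordered sum; the term at 0
    vanishes, so the range can then be cut down to positive \<open>n\<close>.\<close>
  have "((\<lambda>n. ky_weight k n * star_poly (dual_rev ?ms) n x) has_sum ky_series k (dual_rev ?ms) x) UNIV"
    using ky_sums[OF assms(3,4) is_index_dual_rev, of x] assms(5,6)
    by (intro sums_nonneg_imp_has_sum) (auto simp: ky_weight_nonneg star_poly_nonneg)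
  then have *: "((\<lambda>n. ky_weight k n * star_poly (dual_rev ?ms) n x) has_sum ky_series k (dual_rev ?ms) x) {1..}"
    by (subst (asm) has_sum_cong_neutral[where T = "{1..}" and g = "\<lambda>n. ky_weight k n * star_poly (dual_rev ?ms) n x"])
       (auto simp: not_le)
  have lhs: "mhs (n - 1) (tl k) * mhs_star_param n (hoffman_dual (m_index m p)) x / real n ^ (hd k + 1) =
      ky_weight k n * star_poly (dual_rev ?ms) n x" for n
    unfolding dual mhs_star_param_eq[OF dual_rev_nonempty[OF ms]] by (simp add: ky_weight_def)
  have "ky_series k (dual_rev ?ms) x = (-1) ^ length ?ms * mpl_part k c ?ms x + ky_part k ?ms x"
    using ms assms by (intro ky_series_eq) auto
  also have "length ?ms = p" by (simp del: upt_Suc)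
  also have "ky_part k ?ms x = (\<Sum>j=1..p. (-1) ^ (p - j)
             * kaneko_yamamoto k (1 # hoffman_dual (m_index m j))
             * Li (map (\<lambda>l. m l + 1) (rev [Suc j..<Suc p])) (1 - x))"
    using assms(3,4,2) by (rule ky_part_upt)
  also have "mpl_part k c ?ms x = (\<Sum>(k', j)\<in>kt_range k. c k' j *
          (\<Sum>js | length js = p + 1 \<and> sum_list js = j.
             (-1) ^ (js ! 0) / fact (js ! 0)
             * (\<Prod>l=1..p. real ((m l + js ! l) choose (js ! l)))
             * ln (1 - x) ^ (js ! 0)
             * Li (map (\<lambda>l. m l + js ! l + 1) (rev [1..<Suc p]) @ k') (1 - x)))"
    using assms(6) by (simp only: mpl_part_def Li_log_sum_compositions diff_gt_0_iff_gt)
  finally show ?thesis using * unfolding lhs by (simp only:)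
qed

end
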